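(* Let $q$ be a power of $2$, let $m$ be a positive integer, and let $a\in\mathbb{F}_q^*$. Let $f$ be a degenerate quadratic form over $\mathbb{F}_{q^m}$ with $\mathrm{rank}\, f=2s$ ($2s<m$), which is equivalent to Type I. Let $D_f=\{x\in\mathbb{F}_{q^m}: f(x)=a\}$ and let $\mathcal{C}_{D_f}=\{(\mathrm{Tr}(xd))_{d\in D_f}: x\in\mathbb{F}_{q^m}\}$, a linear code over $\mathbb{F}_q$ of length $|D_f|$. Then $\mathcal{C}_{D_f}$ has the following weight hierarchy: $$d_r(\mathcal{C}_{D_f})=\begin{cases} q^{m-1}-q^{m-s-1}-q^{m-2}, & \text{if } r=1,\\ q^{m-1}-q^{m-s-1}-q^{m-r-1}-q^{m-s-2}, & \text{if } 2\le r\le s,\\ q^{m-1}-q^{m-s-1}-q^{m-r-1}-q^{m-r-2}, & \text{if } s<r<m-1,\\ q^{m-1}-q^{m-s-1}-1, & \text{if } r=m-1,\\ q^{m-1}-q^{m-s-1}, & \text{if } r=m.\end{cases}$$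
   Context: $\mathrm{Tr}$ is the trace from $\mathbb{F}_{q^m}$ to $\mathbb{F}_q$. Generalized Hamming weights: for a $k$-dimensional linear code $\mathcal{C}\subseteq\mathbb{F}_q^n$ and an $\mathbb{F}_q$-subspace $H$ of $\mathcal{C}$, $\mathrm{supp}(H)=\{i: c_i\ne 0 \text{ for some } (c_1,\dots,c_n)\in H\}$. For $1\le r\le k$, $d_r(\mathcal{C})=\min\{|\mathrm{supp}(H)| : H \text{ an } r\text{-dimensional subspace of } \mathcal{C}\}$; the set $\{d_1(\mathcal C),\dots,d_k(\mathcal C)\}$ is the weight hierarchy of $\mathcal{C}$. Quadratic forms: fix a basis $\varepsilon_1,\dots,\varepsilon_m$ of $\mathbb{F}_{q^m}$ over $\mathbb{F}_q$ and identify $x=\sum x_i\varepsilon_i$ with $(x_1,\dots,x_m)\in\mathbb{F}_q^m$. A quadratic form over $\mathbb{F}_{q^m}$ is a map $f:\mathbb{F}_{q^m}\to\mathbb{F}_q$ of the form $f(x)=\sum_{1\le i\le j\le m}a_{ij}x_ix_j$ with $a_{ij}\in\mathbb{F}_q$. Put $\ker f=\{x\in\mathbb{F}_{q^m}: f(x+y)=f(y)\text{ for all }y\in\mathbb{F}_{q^m}\}$ (an $\mathbb{F}_q$-subspace). $f$ is non-degenerate if $\ker f=\{0\}$, and degenerate otherwise; $\mathrm{rank}\, f=m-\dim_{\mathbb{F}_q}\ker f$. Types: a quadratic form of rank $t$ is equivalent, under an invertible $\mathbb{F}_q$-linear change of coordinates, to exactly one of: Type I ($t$ even): $x_1x_2+x_3x_4+\cdots+x_{t-1}x_t$;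 Type II ($t$ even): $x_1x_2+\cdots+x_{t-3}x_{t-2}+\alpha x_{t-1}^2+x_{t-1}x_t+\alpha x_t^2$ with $\alpha\in\mathbb{F}_q\setminus\{x^2+x: x\in\mathbb{F}_q\}$; Type III ($t$ odd): $x_1x_2+\cdots+x_{t-2}x_{t-1}+x_t^2$.
   Formalization: The formula fails as printed in small cases, so s ≥ 1 is assumed, s = 1 with q = 2 is excluded (there dim C = m−1), and the case s < r < m−1 is asserted only for s ≥ 2 (for s = 1, q = 4, m = 4, r = 2 the true value is 44, not 43). *)

theory Defs
  imports Complex_Main "HOL-Library.Cardinality" "HOL-Library.Function_Algebras"
begin

section \<open>Field extensions and the trace\<close>

text \<open>
  The base field and its extension of degree \<open>m\<close> are finite field types \<open>'a\<close> and \<open>'b\<close>, and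
  the extension structure is an embedding \<open>\<iota>\<close> of \<open>'a\<close> into \<open>'b\<close>. All linear algebra below uses the
  locale constants of \<open>module\<close> and \<open>vector_space\<close>, instantiated with an explicit scalar multiplication.
\<close>

definition field_embedding :: "('a::field \<Rightarrow> 'b::field) \<Rightarrow> bool" where
  "field_embedding \<iota> \<longleftrightarrow>
     \<iota> 1 = 1 \<and> (\<forall>x y. \<iota> (x + y) = \<iota> x + \<iota> y) \<and> (\<forall>x y. \<iota> (x * y) = \<iota> x * \<iota> y)"

definition ext_scale :: "('a::field \<Rightarrow> 'b::field) \<Rightarrow> 'a \<Rightarrow> 'b \<Rightarrow> 'b" where
  "ext_scale \<iota> c x = \<iota> c * x"

text \<open>The conjugate sum lies in the image of \<open>\<iota>\<close>; the trace is its unique preimage.\<close>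

definition field_trace :: "('a::{field,finite} \<Rightarrow> 'b::field) \<Rightarrow> nat \<Rightarrow> 'b \<Rightarrow> 'a" where
  "field_trace \<iota> m x = (THE c. \<iota> c = (\<Sum>i<m. x ^ (CARD('a) ^ i)))"

section \<open>Quadratic forms\<close>

definition is_basis :: "('a::field \<Rightarrow> 'b::field) \<Rightarrow> nat \<Rightarrow> (nat \<Rightarrow> 'b) \<Rightarrow> bool" where
  "is_basis \<iota> m \<epsilon> \<longleftrightarrow>
     inj_on \<epsilon> {1..m} \<and>
     module.independent (ext_scale \<iota>) (\<epsilon> ` {1..m}) \<and>
     module.span (ext_scale \<iota>) (\<epsilon> ` {1..m}) = UNIV"

definition coord :: "('a::field \<Rightarrow> 'b::field) \<Rightarrow> nat \<Rightarrow> (nat \<Rightarrow> 'b) \<Rightarrow> 'b \<Rightarrow> nat \<Rightarrow> 'a" where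
  "coord \<iota> m \<epsilon> x i = module.representation (ext_scale \<iota>) (\<epsilon> ` {1..m}) x (\<epsilon> i)"

definition quadratic_form ::
  "('a::field \<Rightarrow> 'b::field) \<Rightarrow> nat \<Rightarrow> (nat \<Rightarrow> 'b) \<Rightarrow> ('b \<Rightarrow> 'a) \<Rightarrow> bool" where
  "quadratic_form \<iota> m \<epsilon> f \<longleftrightarrow>
     (\<exists>A :: nat \<Rightarrow> nat \<Rightarrow> 'a. \<forall>x.
        f x = (\<Sum>i\<in>{1..m}. \<Sum>j\<in>{i..m}. A i j * coord \<iota> m \<epsilon> x i * coord \<iota> m \<epsilon> x j))"

definition qf_ker :: "('b::field \<Rightarrow> 'a::field) \<Rightarrow> 'b set" where
  "qf_ker f = {x. \<forall>y. f (x + y) = f y}"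

definition qf_degenerate :: "('b::field \<Rightarrow> 'a::field) \<Rightarrow> bool" where
  "qf_degenerate f \<longleftrightarrow> qf_ker f \<noteq> {0}"

definition qf_rank :: "('a::field \<Rightarrow> 'b::field) \<Rightarrow> nat \<Rightarrow> ('b \<Rightarrow> 'a) \<Rightarrow> nat" where
  "qf_rank \<iota> m f = m - vector_space.dim (ext_scale \<iota>) (qf_ker f)"

definition qf_equivalent ::
  "('a::field \<Rightarrow> 'b::field) \<Rightarrow> ('b \<Rightarrow> 'a) \<Rightarrow> ('b \<Rightarrow> 'a) \<Rightarrow> bool" where
  "qf_equivalent \<iota> f g \<longleftrightarrow>
     (\<exists>T. Vector_Spaces.linear (ext_scale \<iota>) (ext_scale \<iota>) T \<and> bij T \<and> (\<forall>x. f (T x) = g x))"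

text \<open>The Type I form of rank \<open>2 * s\<close>, in the coordinates of the fixed basis; meant for \<open>2 * s \<le> m\<close>.\<close>

definition type_I_form ::
  "('a::field \<Rightarrow> 'b::field) \<Rightarrow> nat \<Rightarrow> (nat \<Rightarrow> 'b) \<Rightarrow> nat \<Rightarrow> 'b \<Rightarrow> 'a" where
  "type_I_form \<iota> m \<epsilon> s x =
     (\<Sum>k\<in>{1..s}. coord \<iota> m \<epsilon> x (2 * k - 1) * coord \<iota> m \<epsilon> x (2 * k))"

section \<open>Linear codes and generalized Hamming weights\<close>

text \<open>
  Words are functions from a type \<open>'i\<close> of positions to the base field. A code whose positions form
  a subset \<open>D\<close> of \<open>'i\<close> consists of words that vanish outside \<open>D\<close>.
\<close>

definition word_scale :: "'a::field \<Rightarrow> ('i \<Rightarrow> 'a) \<Rightarrow> ('i \<Rightarrow> 'a)" where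
  "word_scale c w = (\<lambda>i. c * w i)"

definition code_dim :: "('i \<Rightarrow> 'a::field) set \<Rightarrow> nat" where
  "code_dim C = vector_space.dim word_scale C"

definition code_supp :: "('i \<Rightarrow> 'a::field) set \<Rightarrow> 'i set" where
  "code_supp H = {i. \<exists>w\<in>H. w i \<noteq> 0}"

definition gen_hamming_weight :: "('i::finite \<Rightarrow> 'a::{field,finite}) set \<Rightarrow> nat \<Rightarrow> nat" where
  "gen_hamming_weight C r =
     Min {card (code_supp H) | H. H \<subseteq> C \<and> module.subspace word_scale H \<and> code_dim H = r}"

definition trace_code ::
  "('a::{field,finite} \<Rightarrow> 'b::field) \<Rightarrow> nat \<Rightarrow> 'b set \<Rightarrow> ('b \<Rightarrow> 'a) set" where
  "trace_code \<iota> m D = range (\<lambda>x. \<lambda>d. if d \<in> D then field_trace \<iota> m (x * d) else 0)"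

end

theory Submission
  imports Defs "HOL-Library.FuncSet" "HOL-Computational_Algebra.Primes" "HOL-Computational_Algebra.Polynomial"
begin

text \<open>
  Write \<open>q\<close> for the order of the base field. The support of the subcode given by a subspace \<open>X\<close> is
  \<open>D\<close> minus the trace dual of \<open>X\<close>, so the \<open>r\<close>-th weight is \<open>card D\<close> minus the largest number
  of points of \<open>D\<close> in a subspace \<open>W\<close> of codimension \<open>r\<close>. Squaring is bijective, hence all nonzero
  values of the form \<open>f\<close> are taken equally often on \<open>W\<close>, and one has to minimise the number \<open>Z W\<close> of its zeros.

  If \<open>f x \<noteq> 0\<close>, the orthogonal space of \<open>x\<close> contains \<open>x\<close> (characteristic two), and each of
  its cosets modulo \<open>x\<close> contains exactly one zero; this gives \<open>q\<^sup>2 * Z W \<ge> card W\<close>. If \<open>T\<close> is a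
  totally singular subspace of \<open>W\<close> and \<open>Q\<close> its orthogonal space in \<open>W\<close>, then translating by \<open>T\<close> gives
  \<open>q * Z W + card Q = card W + q * Z Q\<close>. Taking for \<open>T\<close> the intersection of \<open>W\<close> with a fixed maximal
  totally singular subspace, of order \<open>q ^ (m - s)\<close>, one has \<open>card Q \<le> q ^ (m - s)\<close>. These facts
  give the lower bounds for \<open>Z W\<close>; apart from codimension 1 and dimensions 0 and 1 they are attained by subspaces on which \<open>f\<close>
  has Type II.
\<close>

section \<open>Counting in finite vector spaces\<close>

lemma card_field_ge_2: "2 \<le> CARD('a::{field,finite})"
  using card_mono[of UNIV "{0, 1 :: 'a}"] by simp

locale finite_vector_space = vector_space scale
  for scale :: "'a::{field,finite} \<Rightarrow> 'b::{ab_group_add,finite} \<Rightarrow> 'b" (infixr \<open>*s\<close> 75)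
begin

lemma card_pos_subspace: "subspace S \<Longrightarrow> 0 < card S"
  using subspace_0 by (auto simp: card_gt_0_iff)

lemma card_span_independent:
  assumes "independent B"
  shows "card (span B) = CARD('a) ^ card B"
  using finite[of B] assms
proof (induction B rule: finite_induct)
  case empty
  then show ?case by (simp add: span_empty)
next
  case (insert b B)
  have ind: "independent B" and b: "b \<notin> span B"
    using insert.prems insert.hyps independent_insert by auto
  have "bij_betw (\<lambda>(k, v). v + k *s b) (UNIV \<times> span B) (span (insert b B))"
  proof (rule bij_betw_imageI)
    show "inj_on (\<lambda>(k, v). v + k *s b) (UNIV \<times> span B)"
    proof (rule inj_onI, clarify)
      fix k v l w assume v: "v \<in> span B" "w \<in> span B" and eq: "v + k *s b = w + l *s b"
      have "(k - l) *s b = w - v"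
        using eq by (simp add: scale_left_diff_distrib algebra_simps)
      then have "(k - l) *s b \<in> span B"
        using v by (simp add: span_diff)
      then have "k = l"
        using b span_scale[of "(k - l) *s b" B "inverse (k - l)"] by (cases "k = l") simp_all
      then show "k = l \<and> v = w"
        using eq by simp
    qed
    have "x \<in> (\<lambda>(k, v). v + k *s b) ` (UNIV \<times> span B)" if "x - k *s b \<in> span B" for x k
      by (rule image_eqI[of _ _ "(k, x - k *s b)"]) (use that in auto)
    moreover have "v + k *s b \<in> span (insert b B)" if "v \<in> span B" for v k
      unfolding span_insert using that by (auto intro!: exI[of _ k])
    ultimately show "(\<lambda>(k, v). v + k *s b) ` (UNIV \<times> span B) = span (insert b B)"
      unfolding span_insert by (intro equalityI subsetI) (auto simp del: mem_Collect_eq, simp)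
  qed
  then have "card (span (insert b B)) = CARD('a) * card (span B)"
    using bij_betw_same_card card_cartesian_product[of "UNIV :: 'a set"] by fastforce
  then show ?case
    using insert.IH[OF ind] insert.hyps by simp
qed

lemma card_subspace_eq_power_dim:
  assumes "subspace S"
  shows "card S = CARD('a) ^ dim S"
  using card_span_independent basis_exists[of S] assms span_subspace by metis

text \<open>Adding a multiple of a vector \<open>z\<close> with \<open>\<phi> z \<noteq> 0\<close>
  carries any level set onto any other, so the q levels share \<open>Y\<close> equally.\<close>

lemma card_level_set_functional:
  fixes \<phi> :: "'b \<Rightarrow> 'a"
  assumes Y: "subspace Y"
    and add: "\<And>x y. \<phi> (x + y) = \<phi> x + \<phi> y" and scale: "\<And>k x. \<phi> (k *s x) = k * \<phi> x"
    and nz: "\<exists>y\<in>Y. \<phi> y \<noteq> 0"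
  shows "CARD('a) * card {y\<in>Y. \<phi> y = c} = card Y"
proof -
  obtain z where z: "z \<in> Y" "\<phi> z \<noteq> 0"
    using nz by blast
  have eq: "card {y\<in>Y. \<phi> y = d} = card {y\<in>Y. \<phi> y = c}" for d
  proof (rule bij_betw_same_card)
    let ?t = "((c - d) / \<phi> z) *s z"
    have t: "?t \<in> Y" "\<phi> ?t = c - d"
      using z Y by (auto simp: scale subspace_scale)
    show "bij_betw (\<lambda>y. y + ?t) {y\<in>Y. \<phi> y = d} {y\<in>Y. \<phi> y = c}"
    proof (rule bij_betw_byWitness[where f' = "\<lambda>y. y - ?t"])
      show "(\<lambda>y. y + ?t) ` {y\<in>Y. \<phi> y = d} \<subseteq> {y\<in>Y. \<phi> y = c}"
        using t Y by (auto simp: add subspace_add)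
      have "\<phi> (y - ?t) = \<phi> y - \<phi> ?t" for y
        using add[of "y - ?t" ?t] by simp
      then show "(\<lambda>y. y - ?t) ` {y\<in>Y. \<phi> y = c} \<subseteq> {y\<in>Y. \<phi> y = d}"
        using t Y by (auto simp: subspace_diff)
    qed auto
  qed
  have "card Y = (\<Sum>d\<in>UNIV. card {y\<in>Y. \<phi> y = d})"
    using sum.group[of Y UNIV \<phi> "\<lambda>_. 1 :: nat"] by simp
  also have "\<dots> = (\<Sum>d\<in>(UNIV :: 'a set). card {y\<in>Y. \<phi> y = c})"
    by (rule sum.cong[OF refl eq])
  finally show ?thesis
    by simp
qed

text \<open>Double counting of the pairs with \<open>\<beta> x y = 0\<close>: a vector outside the
  radical of its side annihilates one q-th of the opposite space, a vector inside annihilates all of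
  it. Comparing the two counts leaves the claim multiplied by \<open>q - 1\<close>.\<close>

lemma card_annihilator:
  fixes \<beta> :: "'b \<Rightarrow> 'b \<Rightarrow> 'a"
  assumes X: "subspace X" and Y: "subspace Y"
    and addl: "\<And>x x' y. \<beta> (x + x') y = \<beta> x y + \<beta> x' y"
    and addr: "\<And>x y y'. \<beta> x (y + y') = \<beta> x y + \<beta> x y'"
    and scalel: "\<And>k x y. \<beta> (k *s x) y = k * \<beta> x y"
    and scaler: "\<And>k x y. \<beta> x (k *s y) = k * \<beta> x y"
  shows "card X * card {y\<in>Y. \<forall>x\<in>X. \<beta> x y = 0} = card Y * card {x\<in>X. \<forall>y\<in>Y. \<beta> x y = 0}"
proof -
  define X0 where "X0 = {x\<in>X. \<forall>y\<in>Y. \<beta> x y = 0}"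
  define Y0 where "Y0 = {y\<in>Y. \<forall>x\<in>X. \<beta> x y = 0}"
  define q where "q = CARD('a)"
  have q: "q > 1"
    unfolding q_def using card_field_ge_2[where 'a = 'a] by simp
  have sub: "X0 \<subseteq> X" "Y0 \<subseteq> Y"
    by (auto simp: X0_def Y0_def)
  have "q * card {y\<in>Y. \<beta> x y = 0} = (if x \<in> X0 then q * card Y else card Y)" if "x \<in> X" for x
  proof (cases "x \<in> X0")
    case True
    then have "{y\<in>Y. \<beta> x y = 0} = Y"
      by (auto simp: X0_def)
    then show ?thesis using True by simp
  next
    case False
    then show ?thesis
      using that card_level_set_functional[OF Y, of "\<beta> x" 0] by (auto simp: q_def X0_def addr scaler)
  qed
  then have "q * (\<Sum>x\<in>X. card {y\<in>Y. \<beta> x y = 0}) = (\<Sum>x\<in>X. if x \<in> X0 then q * card Y else card Y)"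
    by (simp add: sum_distrib_left)
  also have "\<dots> = q * card Y * card X0 + card Y * card (X - X0)"
    using sub by (simp add: sum.If_cases Int_absorb1 Diff_eq mult.commute)
  finally have 1: "q * (\<Sum>x\<in>X. card {y\<in>Y. \<beta> x y = 0})
      = q * card Y * card X0 + card Y * card (X - X0)" .
  have "q * card {x\<in>X. \<beta> x y = 0} = (if y \<in> Y0 then q * card X else card X)" if "y \<in> Y" for y
  proof (cases "y \<in> Y0")
    case True
    then have "{x\<in>X. \<beta> x y = 0} = X"
      by (auto simp: Y0_def)
    then show ?thesis using True by simp
  next
    case False
    then show ?thesis
      using that card_level_set_functional[OF X, of "\<lambda>x. \<beta> x y" 0] by (auto simp: q_def Y0_def addl scalel)
  qed
  then have "q * (\<Sum>y\<in>Y. card {x\<in>X. \<beta> x y = 0}) = (\<Sum>y\<in>Y. if y \<in> Y0 then q * card X else card X)"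
    by (simp add: sum_distrib_left)
  also have "\<dots> = q * card X * card Y0 + card X * card (Y - Y0)"
    using sub by (simp add: sum.If_cases Int_absorb1 Diff_eq mult.commute)
  finally have 2: "q * (\<Sum>y\<in>Y. card {x\<in>X. \<beta> x y = 0})
      = q * card X * card Y0 + card X * card (Y - Y0)" .
  have "(\<Sum>x\<in>X. card {y\<in>Y. \<beta> x y = 0}) = (\<Sum>y\<in>Y. card {x\<in>X. \<beta> x y = 0})"
    by (rule sum_multicount_gen) auto
  with 1 2 have eq: "q * card Y * card X0 + card Y * card (X - X0)
      = q * card X * card Y0 + card X * card (Y - Y0)"
    by simp
  \<comment> \<open>Over the integers the orders of the set differences are genuine subtractions, so
    that the common term \<open>card X * card Y\<close> cancels.\<close>
  have "int q * card Y * card X0 + card Y * (int (card X) - card X0)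
      = q * card X * card Y0 + card X * (int (card Y) - card Y0)"
    using arg_cong[OF eq, of int] sub by (simp add: card_Diff_subset of_nat_diff card_mono)
  then have "(int q - 1) * (card X * card Y0) = (int q - 1) * (card Y * card X0)"
    by (simp add: algebra_simps)
  then have "int (card X * card Y0) = int (card Y * card X0)"
    using q by simp
  then show ?thesis
    unfolding X0_def Y0_def by linarith
qed

text \<open>Every fibre of addition on \<open>X \<times> Y\<close> is a translate of the
  antidiagonal copy \<open>(u, - u)\<close> of \<open>X \<inter> Y\<close>.\<close>

lemma card_sum_Int:
  assumes X: "subspace X" and Y: "subspace Y"
  shows "card {x + y |x y. x \<in> X \<and> y \<in> Y} * card (X \<inter> Y) = card X * card Y"
proof -
  let ?S = "{x + y |x y. x \<in> X \<and> y \<in> Y}"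
  have "card {p\<in>X \<times> Y. fst p + snd p = v} = card (X \<inter> Y)" if vS: "v \<in> ?S" for v
  proof -
    obtain x y where v: "v = x + y" "x \<in> X" "y \<in> Y"
      using vS by blast
    have bij: "bij_betw (\<lambda>u. (x + u, y - u)) (X \<inter> Y) {p\<in>X \<times> Y. fst p + snd p = v}"
    proof (rule bij_betw_byWitness[where f' = "\<lambda>p. fst p - x"])
      have "a - x \<in> Y" if "a + b = v" "b \<in> Y" for a b
      proof -
        have "a - x = y - b" using that v by (simp add: algebra_simps)
        then show ?thesis using that v Y by (simp add: subspace_diff)
      qed
      then show "(\<lambda>p. fst p - x) ` {p\<in>X \<times> Y. fst p + snd p = v} \<subseteq> X \<inter> Y"
        using v X by (auto simp: subspace_diff)
    qed (use v X Y in \<open>auto simp: subspace_add subspace_diff algebra_simps\<close>)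
    show ?thesis
      using bij_betw_same_card[OF bij] by simp
  qed
  then have "(\<Sum>v\<in>?S. \<Sum>p\<in>{p\<in>X \<times> Y. fst p + snd p = v}. 1) = card ?S * card (X \<inter> Y)"
    by simp
  moreover have "(\<Sum>v\<in>?S. \<Sum>p\<in>{p\<in>X \<times> Y. fst p + snd p = v}. 1) = (\<Sum>p\<in>X \<times> Y. 1 :: nat)"
    by (rule sum.group) (simp, simp, force)
  ultimately show ?thesis
    by (simp add: card_cartesian_product)
qed

end

section \<open>Quadratic forms in characteristic two\<close>

text \<open>Squaring is the Frobenius map: \<open>(x - y)\<^sup>2\<close> and
  \<open>x\<^sup>2 - y\<^sup>2\<close> differ by a multiple of \<open>1 + 1\<close>, so it is
  injective, and the field is finite.\<close>

lemma square_bij_char2: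
  assumes "(1 :: 'a::{field,finite}) + 1 = 0"
  shows "bij (\<lambda>x :: 'a. x\<^sup>2)"
proof -
  have "inj (\<lambda>x :: 'a. x\<^sup>2)"
  proof (rule injI)
    fix x y :: 'a assume "x\<^sup>2 = y\<^sup>2"
    moreover have "(x - y)\<^sup>2 = x\<^sup>2 - y\<^sup>2 + (1 + 1) * (y * (y - x))"
      by (simp add: power2_eq_square algebra_simps)
    ultimately show "x = y" using assms by simp
  qed
  then show ?thesis
    by (simp add: bij_betw_def finite_UNIV_inj_surj)
qed

text \<open>\<open>B\<close> is the polar form of \<open>f\<close>, pinned down by
  \<open>f_add\<close>; since \<open>1 + 1 = 0\<close> it is alternating as well as
  symmetric.\<close>

locale char2_quadratic_space = finite_vector_space scale
  for scale :: "'a::{field,finite} \<Rightarrow> 'b::{ab_group_add,finite} \<Rightarrow> 'b" (infixr \<open>*s\<close> 75) +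
  fixes f :: "'b \<Rightarrow> 'a" and B :: "'b \<Rightarrow> 'b \<Rightarrow> 'a"
  assumes char2: "(1 :: 'a) + 1 = 0"
    and f_add: "f (x + y) = f x + f y + B x y"
    and f_scale: "f (c *s x) = c\<^sup>2 * f x"
    and B_add_right: "B x (y + z) = B x y + B x z"
    and B_scale_right: "B x (c *s y) = c * B x y"
begin

lemma B_commute: "B x y = B y x"
  using f_add[of x y] f_add[of y x] by (simp add: add.commute)

lemma B_add_left: "B (x + y) z = B x z + B y z"
  by (metis B_commute B_add_right)

lemma B_scale_left: "B (c *s x) y = c * B x y"
  by (metis B_commute B_scale_right)

lemma f_zero: "f 0 = 0"
  using f_scale[of 0 0] by simp

lemma B_zero: "B x 0 = 0" "B 0 x = 0"
  using B_scale_right[of x 0 0] B_scale_left[of 0 0 x] by auto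

lemma B_self: "B x x = 0"
proof -
  have "x + x = (1 + 1) *s x"
    unfolding scale_left_distrib by simp
  then have "f (x + x) = 0" unfolding char2 by (simp add: f_zero)
  moreover have "f x + f x = (1 + 1) * f x"
    unfolding distrib_right by simp
  ultimately show ?thesis
    using f_add[of x x] unfolding char2 by simp
qed

abbreviation zeros :: "'b set \<Rightarrow> 'b set" where
  "zeros W \<equiv> {w\<in>W. f w = 0}"

definition perp :: "'b set \<Rightarrow> 'b set \<Rightarrow> 'b set" where
  "perp W T = {w\<in>W. \<forall>t\<in>T. B w t = 0}"

lemma subspace_perp: "subspace W \<Longrightarrow> subspace (perp W T)"
  by (auto simp: perp_def subspace_def B_add_left B_scale_left B_zero)

lemma card_translate_zeros:
  assumes "subspace W" "t \<in> W"
  shows "card {w\<in>W. f (w + t) = 0} = card (zeros W)"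
proof (rule bij_betw_same_card)
  show "bij_betw (\<lambda>w. w + t) {w\<in>W. f (w + t) = 0} (zeros W)"
    by (rule bij_betw_byWitness[where f' = "\<lambda>w. w - t"])
       (use assms in \<open>auto simp: subspace_add subspace_diff\<close>)
qed

text \<open>On \<open>perp W {x}\<close> the polar term drops out and
  \<open>f (w + c *s x) = f w + c\<^sup>2 * f x\<close>, which vanishes for exactly one
  \<open>c\<close>, because square roots exist and are unique. Translation by a multiple of
  \<open>x\<close> preserves the number of zeros, so summing over \<open>w\<close> and
  \<open>c\<close> in both orders gives the count.\<close>

lemma card_perp_anisotropic:
  assumes W: "subspace W" and x: "x \<in> W" "f x \<noteq> 0"
  shows "CARD('a) * card (zeros (perp W {x})) = card (perp W {x})"
proof -
  let ?P = "perp W {x}"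
  have P: "subspace ?P" by (rule subspace_perp[OF W])
  have xP: "x \<in> ?P" using x by (simp add: perp_def B_self)
  have "card {c :: 'a. f (w + c *s x) = 0} = 1" if "w \<in> ?P" for w
  proof -
    have val: "f (w + c *s x) = f w + c\<^sup>2 * f x" for c
      using that by (simp add: f_add f_scale B_scale_right perp_def)
    have "\<exists>!c :: 'a. c\<^sup>2 = - f w / f x"
      using square_bij_char2[OF char2] unfolding bij_iff by metis
    moreover have "f (w + c *s x) = 0 \<longleftrightarrow> c\<^sup>2 = - f w / f x" for c
      unfolding val using x(2) by (auto simp: field_simps eq_neg_iff_add_eq_0 add.commute)
    ultimately have "\<exists>c. {c :: 'a. f (w + c *s x) = 0} = {c}" by auto
    then show ?thesis by force
  qed
  then have "(\<Sum>w\<in>?P. card {c :: 'a. f (w + c *s x) = 0}) = card ?P"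
    by simp
  moreover have "(\<Sum>w\<in>?P. card {c :: 'a. f (w + c *s x) = 0})
      = (\<Sum>c::'a\<in>UNIV. card {w\<in>?P. f (w + c *s x) = 0})"
    using sum_multicount_gen[of ?P "UNIV :: 'a set" "\<lambda>w c. f (w + c *s x) = 0"
        "\<lambda>c. card {w\<in>?P. f (w + c *s x) = 0}"] by simp
  moreover have "card {w\<in>?P. f (w + c *s x) = 0} = card (zeros ?P)" for c
    by (rule card_translate_zeros[OF P]) (simp add: P xP subspace_scale)
  ultimately show ?thesis by simp
qed

text \<open>The orthogonal space of an anisotropic vector has index at most q in \<open>W\<close>,
  and one q-th of it consists of zeros. Each of the two steps costs one factor q.\<close>

lemma card_le_card_zeros:
  assumes W: "subspace W"
  shows "card W \<le> CARD('a)\<^sup>2 * card (zeros W)"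
proof (cases "\<forall>w\<in>W. f w = 0")
  case True
  then have "zeros W = W" by auto
  then show ?thesis by simp
next
  case False
  then obtain x where x: "x \<in> W" "f x \<noteq> 0" by blast
  let ?P = "perp W {x}"
  have "card W \<le> CARD('a) * card ?P"
  proof (cases "\<exists>w\<in>W. B x w \<noteq> 0")
    case True
    then show ?thesis
      using card_level_set_functional[OF W, of "B x" 0]
      by (simp add: B_add_right B_scale_right perp_def B_commute)
  next
    case False
    then have "?P = W" by (auto simp: perp_def B_commute)
    then show ?thesis by simp
  qed
  also have "\<dots> = CARD('a)\<^sup>2 * card (zeros ?P)"
    using card_perp_anisotropic[OF W x] by (simp add: power2_eq_square)
  also have "\<dots> \<le> CARD('a)\<^sup>2 * card (zeros W)"
    by (intro mult_le_mono2 card_mono) (auto simp: perp_def)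
  finally show ?thesis .
qed

text \<open>The pairs \<open>(w, t)\<close> with \<open>f (w + t) = 0\<close> are counted in two
  ways. As \<open>f (w + t) = f w + B w t\<close>, for \<open>w\<close> orthogonal to
  \<open>T\<close> the coset \<open>w + T\<close> consists of zeros or contains none, and otherwise
  exactly one q-th of it are zeros. Cancelling \<open>card T\<close> gives the formula.\<close>

lemma card_zeros_singular_subspace:
  assumes W: "subspace W" and T: "subspace T" "T \<subseteq> W" and sing: "\<And>t. t \<in> T \<Longrightarrow> f t = 0"
  shows "CARD('a) * card (zeros W) + card (perp W T) = card W + CARD('a) * card (zeros (perp W T))"
proof -
  let ?Q = "perp W T" and ?q = "CARD('a)"
  have sub: "?Q \<subseteq> W" by (auto simp: perp_def)
  have "?q * card {t\<in>T. f (w + t) = 0} =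
      (if w \<in> ?Q then (if f w = 0 then ?q * card T else 0) else card T)" if w: "w \<in> W" for w
  proof (cases "w \<in> ?Q")
    case True
    then have "{t\<in>T. f (w + t) = 0} = (if f w = 0 then T else {})"
      by (auto simp: perp_def f_add sing)
    then show ?thesis using True by simp
  next
    case False
    have "{t\<in>T. f (w + t) = 0} = {t\<in>T. B w t = - f w}"
      by (auto simp: f_add sing eq_neg_iff_add_eq_0 add.commute[of _ "f w"])
    then show ?thesis
      using False w card_level_set_functional[OF T(1), of "B w" "- f w"]
      by (auto simp: perp_def B_add_right B_scale_right)
  qed
  then have "?q * (\<Sum>w\<in>W. card {t\<in>T. f (w + t) = 0})
      = (\<Sum>w\<in>W. if w \<in> ?Q then (if f w = 0 then ?q * card T else 0) else card T)"
    by (simp add: sum_distrib_left)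
  also have "\<dots> = (\<Sum>w\<in>?Q. if f w = 0 then ?q * card T else 0) + card T * card (W - ?Q)"
    using sub by (simp add: sum.If_cases Int_absorb1 Diff_eq mult.commute)
  also have "\<dots> = card T * (?q * card (zeros ?Q) + card (W - ?Q))"
    by (simp add: sum.inter_filter[symmetric] distrib_left mult_ac)
  also have "(\<Sum>w\<in>W. card {t\<in>T. f (w + t) = 0}) = (\<Sum>t\<in>T. card {w\<in>W. f (w + t) = 0})"
    by (rule sum_multicount_gen) auto
  also have "\<dots> = card T * card (zeros W)"
    using T(2) card_translate_zeros[OF W] by (simp add: subset_iff)
  finally have "card T * (?q * card (zeros W)) = card T * (?q * card (zeros ?Q) + card (W - ?Q))"
    by (simp add: mult_ac)
  then have "?q * card (zeros W) = ?q * card (zeros ?Q) + card (W - ?Q)"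
    using card_pos_subspace[OF T(1)] unfolding mult_cancel1 by linarith
  moreover have "card (W - ?Q) + card ?Q = card W"
    using sub by (simp add: card_Diff_subset card_mono)
  ultimately show ?thesis by linarith
qed

lemma card_level_set_form:
  assumes W: "subspace W" and a: "a \<noteq> 0"
  shows "(CARD('a) - 1) * card {w\<in>W. f w = a} + card (zeros W) = card W"
proof -
  have eq: "card {w\<in>W. f w = b} = card {w\<in>W. f w = a}" if "b \<noteq> 0" for b
  proof -
    \<comment> \<open>A scalar whose square is \<open>a / b\<close> carries level \<open>b\<close>
      onto level \<open>a\<close>, as \<open>f\<close> is homogeneous of degree two.\<close>
    obtain c where c: "c\<^sup>2 = a / b"
      using surjD[OF bij_is_surj[OF square_bij_char2[OF char2]], of "a / b"] by auto
    then have c0: "c \<noteq> 0" using a that by auto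
    show ?thesis
    proof (rule bij_betw_same_card)
      show "bij_betw (\<lambda>w. c *s w) {w\<in>W. f w = b} {w\<in>W. f w = a}"
        by (rule bij_betw_byWitness[where f' = "\<lambda>w. inverse c *s w"])
           (use W a that c c0 in \<open>auto simp: subspace_scale f_scale power_inverse\<close>)
    qed
  qed
  have "card W = (\<Sum>b\<in>UNIV. card {w\<in>W. f w = b})"
    using sum.group[of W UNIV f "\<lambda>_. 1 :: nat"] by simp
  also have "\<dots> = card (zeros W) + (\<Sum>b\<in>UNIV - {0}. card {w\<in>W. f w = b})"
    by (simp add: sum.remove[of _ 0])
  also have "(\<Sum>b\<in>UNIV - {0}. card {w\<in>W. f w = b}) = (CARD('a) - 1) * card {w\<in>W. f w = a}"
    by (simp add: eq)
  finally show ?thesis by simp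
qed

end

section \<open>The degenerate Type I form\<close>

lemma sum_split_first_two:
  fixes g :: "nat \<Rightarrow> 'c::comm_monoid_add"
  assumes "2 \<le> s"
  shows "(\<Sum>k\<in>{1..s}. g k) = g 1 + (g 2 + (\<Sum>k\<in>{3..s}. g k))"
  using assms by (simp add: sum.atLeast_Suc_atMost numeral_eq_Suc)

text \<open>The map \<open>x\<^sup>2 + x\<close> vanishes at both 0 and 1, so on a finite field it
  is not onto. A missed value serves as the constant of the Type II plane.\<close>

lemma exists_not_artin_schreier:
  assumes "(1 :: 'a::{field,finite}) + 1 = 0"
  shows "\<exists>\<alpha> :: 'a. \<forall>x. x\<^sup>2 + x \<noteq> \<alpha>"
proof (rule ccontr)
  assume "\<not> ?thesis"
  then have "surj (\<lambda>x :: 'a. x\<^sup>2 + x)"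
    unfolding surj_def by metis
  then have "inj (\<lambda>x :: 'a. x\<^sup>2 + x)"
    by (rule finite_UNIV_surj_inj[OF finite])
  from injD[OF this, of 0 1] show False
    using assms by simp
qed

text \<open>\<open>y 1\<close> to \<open>y m\<close> are linear coordinates in which
  \<open>f\<close> is literally the Type I sum; the change of variables of the equivalence is
  absorbed in them.\<close>

locale type_I_space = finite_vector_space scale
  for scale :: "'a::{field,finite} \<Rightarrow> 'b::{ab_group_add,finite} \<Rightarrow> 'b" (infixr \<open>*s\<close> 75) +
  fixes y :: "nat \<Rightarrow> 'b \<Rightarrow> 'a" and m s :: nat and f :: "'b \<Rightarrow> 'a"
  assumes char2': "(1 :: 'a) + 1 = 0"
    and y_add: "y i (x + z) = y i x + y i z"
    and y_scale: "y i (c *s x) = c * y i x"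
    and y_inject: "(\<And>i. i \<in> {1..m} \<Longrightarrow> y i x = y i z) \<Longrightarrow> x = z"
    and y_surj: "\<exists>x. \<forall>i\<in>{1..m}. y i x = d i"
    and s_pos: "1 \<le> s" and s_less: "2 * s < m"
    and f_eq: "f x = (\<Sum>k\<in>{1..s}. y (2 * k - 1) x * y (2 * k) x)"
begin

definition B :: "'b \<Rightarrow> 'b \<Rightarrow> 'a" where
  "B x z = (\<Sum>k\<in>{1..s}. y (2 * k - 1) x * y (2 * k) z + y (2 * k) x * y (2 * k - 1) z)"

sublocale char2_quadratic_space scale f B
proof
  show "f (x + z) = f x + f z + B x z" for x z
    by (simp add: f_eq B_def y_add sum.distrib[symmetric] algebra_simps)
  show "f (c *s x) = c\<^sup>2 * f x" for c x
    by (simp add: f_eq y_scale sum_distrib_left power2_eq_square mult_ac)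
  show "B x (z + z') = B x z + B x z'" for x z z'
    by (simp add: B_def y_add sum.distrib[symmetric] algebra_simps)
  show "B x (c *s z) = c * B x z" for c x z
    by (simp add: B_def y_scale sum_distrib_left algebra_simps)
qed (rule char2')

lemma y_zero [simp]: "y i 0 = 0"
  using y_scale[of i 0 0] by simp

lemma q_gt_1: "1 < CARD('a)"
  using card_field_ge_2[where 'a = 'a] by simp

text \<open>The coordinates in \<open>I\<close> are free and determine the others through
  \<open>h\<close>. The argument of \<open>h\<close> is masked to 0 outside \<open>I\<close>, so
  that the prescribed values can depend on free coordinates only.\<close>

lemma card_coordinate_graph:
  assumes I: "I \<subseteq> {1..m}"
  shows "card {x. \<forall>i\<in>{1..m} - I. y i x = h i (\<lambda>j. if j \<in> I then y j x else 0)} = CARD('a) ^ card I"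
proof -
  let ?S = "{x. \<forall>i\<in>{1..m} - I. y i x = h i (\<lambda>j. if j \<in> I then y j x else 0)}"
  have fin: "finite I" using I finite_subset by blast
  have "bij_betw (\<lambda>x. \<lambda>i\<in>I. y i x) ?S (I \<rightarrow>\<^sub>E UNIV)"
  proof (rule bij_betw_imageI)
    show "inj_on (\<lambda>x. \<lambda>i\<in>I. y i x) ?S"
    proof (rule inj_onI)
      fix x z assume xz: "x \<in> ?S" "z \<in> ?S" and eq: "(\<lambda>i\<in>I. y i x) = (\<lambda>i\<in>I. y i z)"
      have eqI: "y i x = y i z" if "i \<in> I" for i
        using fun_cong[OF eq, of i] that by simp
      then have "(\<lambda>j. if j \<in> I then y j x else 0) = (\<lambda>j. if j \<in> I then y j z else 0)"
        by auto
      then have "y i x = y i z" if "i \<in> {1..m}" for i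
        using eqI xz that by (cases "i \<in> I") auto
      then show "x = z" by (rule y_inject)
    qed
    have "c \<in> (\<lambda>x. \<lambda>i\<in>I. y i x) ` ?S" if c: "c \<in> I \<rightarrow>\<^sub>E UNIV" for c
    proof -
      obtain x where x: "\<And>i. i \<in> {1..m} \<Longrightarrow>
          y i x = (if i \<in> I then c i else h i (\<lambda>j. if j \<in> I then c j else 0))"
        using y_surj[of "\<lambda>i. if i \<in> I then c i else h i (\<lambda>j. if j \<in> I then c j else 0)"] by blast
      then have xI: "y i x = c i" if "i \<in> I" for i
        using that I by auto
      then have "(\<lambda>j. if j \<in> I then y j x else 0) = (\<lambda>j. if j \<in> I then c j else 0)"
        by auto
      then have "x \<in> ?S" using x by auto
      moreover have "c = (\<lambda>i\<in>I. y i x)"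
        using c xI by (auto simp: fun_eq_iff PiE_def extensional_def)
      ultimately show ?thesis by blast
    qed
    then show "(\<lambda>x. \<lambda>i\<in>I. y i x) ` ?S = (I \<rightarrow>\<^sub>E UNIV)"
      by auto
  qed
  then show ?thesis
    using fin by (simp add: bij_betw_same_card card_PiE)
qed

lemma card_coordinates_vanish:
  assumes "J \<subseteq> {1..m}"
  shows "card {x. \<forall>i\<in>J. y i x = 0} = CARD('a) ^ (m - card J)"
proof -
  have "{1..m} - ({1..m} - J) = J" using assms by blast
  moreover have "card ({1..m} - J) = m - card J"
    using assms by (simp add: card_Diff_subset finite_subset)
  ultimately show ?thesis
    using card_coordinate_graph[of "{1..m} - J" "\<lambda>_ _. 0"] by simp
qed

lemma subspace_coordinates_vanish: "subspace {x. \<forall>i\<in>J. y i x = 0}"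
  by (auto simp: subspace_def y_add y_scale)

lemma card_UNIV_eq: "CARD('b) = CARD('a) ^ m"
  using card_coordinates_vanish[of "{}"] by simp

text \<open>Here \<open>t\<close> is a coordinate vector. Only the hyperbolic plane of the index
  \<open>i0\<close> contributes to \<open>B w t\<close>, and there the coordinate paired with
  \<open>i0\<close> is read off.\<close>

lemma B_single:
  assumes j: "j \<in> {1..s}" and t: "\<And>i. i \<in> {1..m} \<Longrightarrow> y i t = (if i = i0 then 1 else 0)"
  shows "i0 = 2 * j - 1 \<Longrightarrow> B w t = y (2 * j) w" and "i0 = 2 * j \<Longrightarrow> B w t = y (2 * j - 1) w"
proof -
  have in_m: "2 * k \<in> {1..m}" "2 * k - 1 \<in> {1..m}" if "k \<in> {1..s}" for k
    using that s_less by auto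
  { assume i0: "i0 = 2 * j - 1"
    have "B w t = (\<Sum>k\<in>{1..s}. if k = j then y (2 * j) w else 0)"
      unfolding B_def
    proof (rule sum.cong[OF refl])
      fix k assume k: "k \<in> {1..s}"
      have "2 * k \<noteq> i0" "2 * k - 1 = i0 \<longleftrightarrow> k = j"
        using k j i0 by (auto, presburger)
      then show "y (2 * k - 1) w * y (2 * k) t + y (2 * k) w * y (2 * k - 1) t
          = (if k = j then y (2 * j) w else 0)"
        using t in_m[OF k] by simp
    qed
    then show "B w t = y (2 * j) w" using j by simp }
  { assume i0: "i0 = 2 * j"
    have "B w t = (\<Sum>k\<in>{1..s}. if k = j then y (2 * j - 1) w else 0)"
      unfolding B_def
    proof (rule sum.cong[OF refl])
      fix k assume k: "k \<in> {1..s}"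
      have "2 * k - 1 \<noteq> i0" "2 * k = i0 \<longleftrightarrow> k = j"
        using k j i0 by (auto, presburger)
      then show "y (2 * k - 1) w * y (2 * k) t + y (2 * k) w * y (2 * k - 1) t
          = (if k = j then y (2 * j - 1) w else 0)"
        using t in_m[OF k] by simp
    qed
    then show "B w t = y (2 * j - 1) w" using j by simp }
qed

lemma radical_eq: "{x. \<forall>z. B x z = 0} = {x. \<forall>i\<in>{1..2 * s}. y i x = 0}"
proof (intro set_eqI iffI CollectI ballI)
  fix x i assume x: "x \<in> {x. \<forall>z. B x z = 0}" and i: "i \<in> {1..2 * s}"
  show "y i x = 0"
  proof (cases "even i")
    case True
    then obtain k where k: "i = 2 * k" by blast
    with i have ks: "k \<in> {1..s}" by auto
    obtain t where t: "\<And>i. i \<in> {1..m} \<Longrightarrow> y i t = (if i = 2 * k - 1 then 1 else 0)"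
      using y_surj[of "\<lambda>i. if i = 2 * k - 1 then 1 else 0"] by blast
    show ?thesis using B_single(1)[OF ks t refl, of x] x k by simp
  next
    case False
    then obtain k' where "i = 2 * k' + 1" by (rule oddE)
    with i obtain k where ks: "k \<in> {1..s}" and k: "i = 2 * k - 1" by (intro that[of "Suc k'"]) auto
    obtain t where t: "\<And>i. i \<in> {1..m} \<Longrightarrow> y i t = (if i = 2 * k then 1 else 0)"
      using y_surj[of "\<lambda>i. if i = 2 * k then 1 else 0"] by blast
    show ?thesis using B_single(2)[OF ks t refl, of x] x k by simp
  qed
next
  fix x assume x: "x \<in> {x. \<forall>i\<in>{1..2 * s}. y i x = 0}"
  moreover have "2 * k \<in> {1..2 * s}" "2 * k - 1 \<in> {1..2 * s}" if "k \<in> {1..s}" for k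
    using that by auto
  ultimately have "y (2 * k) x = 0" "y (2 * k - 1) x = 0" if "k \<in> {1..s}" for k
    using that by blast+
  then show "\<forall>z. B x z = 0" by (simp add: B_def)
qed

lemma card_radical: "card {x. \<forall>z. B x z = 0} = CARD('a) ^ (m - 2 * s)"
  unfolding radical_eq using s_less by (subst card_coordinates_vanish) auto

text \<open>The fixed maximal totally singular subspace: killing one coordinate of each hyperbolic
  pair makes every term of \<open>f\<close> vanish and leaves \<open>m - s\<close> coordinates
  free.\<close>

definition L :: "'b set" where
  "L = {x. \<forall>i\<in>(\<lambda>k. 2 * k) ` {1..s}. y i x = 0}"

lemma subspace_L: "subspace L"
  unfolding L_def by (rule subspace_coordinates_vanish)

lemma card_L: "card L = CARD('a) ^ (m - s)"
  unfolding L_def using s_less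
  by (subst card_coordinates_vanish) (auto simp: card_image inj_on_def)

lemma L_singular: "x \<in> L \<Longrightarrow> f x = 0"
  by (auto simp: L_def f_eq)

lemma L_isotropic: "x \<in> L \<Longrightarrow> z \<in> L \<Longrightarrow> B x z = 0"
  using f_add[of x z] subspace_add[OF subspace_L] by (simp add: L_singular)

text \<open>With \<open>T = W \<inter> L\<close> and \<open>S = W + L\<close>, the part
  \<open>T0\<close> of \<open>T\<close> orthogonal to \<open>W\<close> is orthogonal to all of
  \<open>S\<close>, because \<open>T\<close> lies in the isotropic \<open>L\<close>. The orthogonal
  space \<open>S'\<close> of \<open>S\<close> is bounded through the radical by
  \<open>card S * card S' \<le> q ^ (m - s) * q ^ (m - s)\<close>. Together with
  \<open>card T * card Q = card W * card T0\<close> and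
  \<open>card S * card T = card W * card L\<close> everything but one factor
  \<open>q ^ (m - s)\<close> cancels.\<close>

lemma card_perp_Int_L_le:
  assumes W: "subspace W"
  shows "card (perp W (W \<inter> L)) \<le> CARD('a) ^ (m - s)"
proof -
  let ?q = "CARD('a)"
  define T where "T = W \<inter> L"
  define Q where "Q = perp W T"
  define T0 where "T0 = {t\<in>T. \<forall>w\<in>W. B t w = 0}"
  define S where "S = {w + l |w l. w \<in> W \<and> l \<in> L}"
  define S' where "S' = {v. \<forall>x\<in>S. B x v = 0}"
  have T: "subspace T" unfolding T_def by (rule subspace_inter[OF W subspace_L])
  have S: "subspace S" unfolding S_def by (rule subspace_sums[OF W subspace_L])
  have "card T * card {w\<in>W. \<forall>t\<in>T. B t w = 0} = card W * card T0"
    unfolding T0_def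
    by (rule card_annihilator[OF T W]) (simp_all add: B_add_left B_add_right B_scale_left B_scale_right)
  then have 1: "card T * card Q = card W * card T0"
    by (simp add: Q_def perp_def B_commute)
  have "card S * card {v\<in>UNIV. \<forall>x\<in>S. B x v = 0} = CARD('b) * card {x\<in>S. \<forall>v\<in>UNIV. B x v = 0}"
    by (rule card_annihilator[OF S subspace_UNIV])
       (simp_all add: B_add_left B_add_right B_scale_left B_scale_right)
  also have "\<dots> \<le> ?q ^ m * card {x. \<forall>v. B x v = 0}"
    unfolding card_UNIV_eq by (intro mult_le_mono2 card_mono) auto
  also have "\<dots> = ?q ^ (m - s) * ?q ^ (m - s)"
    using s_less by (simp add: card_radical power_add[symmetric] mult_2)
  finally have 2: "card S * card S' \<le> ?q ^ (m - s) * ?q ^ (m - s)"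
    by (simp add: S'_def)
  have 3: "card T0 \<le> card S'"
  proof (intro card_mono subsetI)
    fix t assume t: "t \<in> T0"
    then have "B w t = 0" if "w \<in> W" for w
      using that B_commute[of w t] by (simp add: T0_def)
    moreover have "B l t = 0" if "l \<in> L" for l
      using that t by (simp add: T0_def T_def L_isotropic)
    ultimately show "t \<in> S'"
      by (auto simp: S'_def S_def B_add_left)
  qed simp
  have 4: "card S * card T = card W * ?q ^ (m - s)"
    unfolding S_def T_def using card_sum_Int[OF W subspace_L] by (simp add: card_L)
  have "(card S * card T) * card Q = card S * card W * card T0"
    using 1 by (simp add: mult_ac)
  also have "\<dots> \<le> card S * card W * card S'"
    using 3 by simp
  also have "\<dots> = card W * (card S * card S')"
    by simp
  also have "\<dots> \<le> card W * (?q ^ (m - s) * ?q ^ (m - s))"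
    using 2 by (rule mult_le_mono2)
  also have "\<dots> = (card S * card T) * ?q ^ (m - s)"
    by (simp add: 4)
  finally have "(card S * card T) * card Q \<le> (card S * card T) * ?q ^ (m - s)" .
  moreover have "0 < card S * card T"
    using card_pos_subspace[OF S] card_pos_subspace[OF T] by simp
  ultimately show ?thesis
    unfolding Q_def T_def by (simp add: mult_le_cancel1)
qed

section \<open>Sizes of level sets and their upper bounds on subspaces\<close>

lemma card_zeros_Int_L:
  assumes W: "subspace W"
  shows "CARD('a) * card (zeros W) + card (perp W (W \<inter> L))
    = card W + CARD('a) * card (zeros (perp W (W \<inter> L)))"
  by (rule card_zeros_singular_subspace[OF W subspace_inter[OF W subspace_L]]) (auto simp: L_singular)

text \<open>This gives the length of the code. In the whole space \<open>L\<close> is its own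
  orthogonal space and consists of zeros, so \<open>card_zeros_Int_L\<close> yields the exact number
  of zeros. The additive form avoids truncated subtraction.\<close>

lemma card_level_set_UNIV:
  assumes "a \<noteq> 0"
  shows "card {x. f x = a} + CARD('a) ^ (m - s - 1) = CARD('a) ^ (m - 1)"
proof -
  let ?q = "CARD('a)"
  have sub: "L \<subseteq> perp UNIV L"
    by (auto simp: perp_def L_isotropic)
  have "card (perp UNIV L) \<le> card L"
    using card_perp_Int_L_le[OF subspace_UNIV] by (simp add: card_L)
  with sub have eq: "perp UNIV L = L"
    by (metis card_seteq finite)
  have "zeros L = L" by (auto simp: L_singular)
  with card_zeros_Int_L[OF subspace_UNIV]
  have Z: "?q * card (zeros UNIV) + ?q ^ (m - s) = ?q ^ m + ?q * ?q ^ (m - s)"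
    by (simp add: eq card_L card_UNIV_eq)
  have N: "(?q - 1) * card {x. f x = a} + card (zeros UNIV) = ?q ^ m"
    using card_level_set_form[OF subspace_UNIV assms] by (simp add: card_UNIV_eq)
  \<comment> \<open>Writing q as \<open>Suc p\<close> turns the factor \<open>q - 1\<close> of
    \<open>card_level_set_form\<close> into a positive \<open>p\<close> that can be
    cancelled.\<close>
  obtain p where p: "?q = Suc p" "p > 0"
    using q_gt_1 by (metis Suc_lessE One_nat_def)
  have e: "?q ^ m = ?q * ?q ^ (m - 1)" "?q ^ (m - s) = ?q * ?q ^ (m - s - 1)"
    using s_less by (simp_all flip: power_Suc add: Suc_diff_Suc)
  have Z': "card (zeros UNIV) + ?q ^ (m - s - 1) = ?q ^ (m - 1) + ?q * ?q ^ (m - s - 1)"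
  proof -
    have "?q * (card (zeros UNIV) + ?q ^ (m - s - 1)) = ?q * (?q ^ (m - 1) + ?q * ?q ^ (m - s - 1))"
      using Z unfolding e by (simp add: algebra_simps)
    then show ?thesis using p by (simp only: mult_cancel1) simp
  qed
  have qp: "?q - 1 = p" "?q * c = c + p * c" for c
    using p(1) by simp_all
  have "p * card {x. f x = a} + card (zeros UNIV) = ?q ^ (m - 1) + p * ?q ^ (m - 1)"
    using N unfolding e(1) qp .
  moreover have "card (zeros UNIV) = ?q ^ (m - 1) + p * ?q ^ (m - s - 1)"
    using Z' unfolding qp by simp
  ultimately have "p * (card {x. f x = a} + ?q ^ (m - s - 1)) = p * ?q ^ (m - 1)"
    by (simp only: distrib_left)
  then show ?thesis using p(2) by (simp only: mult_cancel1) simp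
qed

text \<open>A hyperplane meets \<open>L\<close> in at least \<open>q ^ (m - s - 1)\<close> vectors,
  and these are zeros lying in the orthogonal space \<open>?Q\<close> of
  \<open>W \<inter> L\<close>. As \<open>?Q\<close> has at most \<open>q ^ (m - s)\<close> elements,
  at least one q-th of \<open>?Q\<close> are zeros, and then so is at least one q-th of
  \<open>W\<close>.\<close>

lemma level_set_hyperplane_le:
  assumes W: "subspace W" "card W = CARD('a) ^ (m - 1)" and a: "a \<noteq> 0"
  shows "CARD('a) * card {w\<in>W. f w = a} \<le> card W"
proof -
  let ?q = "CARD('a)" and ?Q = "perp W (W \<inter> L)"
  let ?S = "{w + l |w l. w \<in> W \<and> l \<in> L}"
  have "?q ^ (m - s) * card W = card ?S * card (W \<inter> L)"
    using card_sum_Int[OF W(1) subspace_L] by (simp add: card_L)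
  also have "\<dots> \<le> ?q ^ m * card (W \<inter> L)"
    unfolding card_UNIV_eq[symmetric] by (intro mult_le_mono1 card_mono) auto
  also have "\<dots> = card W * (?q * card (W \<inter> L))"
    using s_less W(2) by (simp add: power_eq_if)
  finally have "?q ^ (m - s) \<le> ?q * card (W \<inter> L)"
    using card_pos_subspace[OF W(1)] by (simp add: mult.commute[of _ "card W"])
  also have "\<dots> \<le> ?q * card (zeros ?Q)"
    by (intro mult_le_mono2 card_mono) (auto simp: perp_def L_singular L_isotropic)
  finally have "card ?Q \<le> ?q * card (zeros ?Q)"
    using card_perp_Int_L_le[OF W(1)] by linarith
  with card_zeros_Int_L[OF W(1)] have Z: "card W \<le> ?q * card (zeros W)"
    by linarith
  obtain p where p: "?q = Suc p" "p > 0"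
    using q_gt_1 by (metis Suc_lessE One_nat_def)
  have "p * card {w\<in>W. f w = a} + card (zeros W) = card W"
    using card_level_set_form[OF W(1) a] p by simp
  then have "?q * (p * card {w\<in>W. f w = a}) + ?q * card (zeros W) = ?q * card W"
    by (simp flip: distrib_left)
  with Z have "?q * (p * card {w\<in>W. f w = a}) \<le> p * card W"
    unfolding p(1) by simp
  then have "p * (?q * card {w\<in>W. f w = a}) \<le> p * card W"
    by (simp only: mult.left_commute)
  then show ?thesis using p(2) by (simp only: mult_le_cancel1)
qed

text \<open>The first bound comes from \<open>card_le_card_zeros\<close> for \<open>W\<close>
  itself, the second from \<open>card_le_card_zeros\<close> for the orthogonal space
  \<open>?Q\<close> of \<open>W \<inter> L\<close>, where \<open>card ?Q \<le> q ^ (m - s)\<close>.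
  In codimension \<open>r\<close> the second is sharper for \<open>r < s\<close>, the first for
  \<open>r > s\<close>.\<close>

lemma level_set_subspace_le:
  assumes W: "subspace W" and a: "a \<noteq> 0"
  shows "(CARD('a))\<^sup>2 * card {w\<in>W. f w = a} \<le> (CARD('a) + 1) * card W"
    and "(CARD('a))\<^sup>2 * card {w\<in>W. f w = a} \<le> CARD('a) * card W + CARD('a) ^ (m - s)"
proof -
  let ?q = "CARD('a)" and ?Q = "perp W (W \<inter> L)"
  obtain p where p: "?q = Suc p" "p > 0"
    using q_gt_1 by (metis Suc_lessE One_nat_def)
  define N where "N = card {w\<in>W. f w = a}"
  have "p * N + card (zeros W) = card W"
    using card_level_set_form[OF W a] p by (simp add: N_def)
  then have "?q\<^sup>2 * (p * N + card (zeros W)) = ?q\<^sup>2 * card W"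
    by simp
  then have N: "p * (?q\<^sup>2 * N) + ?q\<^sup>2 * card (zeros W) = ?q\<^sup>2 * card W"
    by (simp only: distrib_left mult.left_commute)
  have q2: "?q\<^sup>2 * c = p * ((?q + 1) * c) + c" "?q\<^sup>2 * c = p * (?q * c) + ?q * c" for c
    unfolding p(1) by (simp_all add: power2_eq_square algebra_simps)
  have "p * (?q\<^sup>2 * N) \<le> p * ((?q + 1) * card W)"
    using N card_le_card_zeros[OF W] q2(1)[of "card W"] by linarith
  then show "?q\<^sup>2 * card {w\<in>W. f w = a} \<le> (?q + 1) * card W"
    using p(2) unfolding N_def by (simp only: mult_le_cancel1)
  have "?q * (?q * card (zeros W) + card ?Q) = ?q * (card W + ?q * card (zeros ?Q))"
    using card_zeros_Int_L[OF W] by simp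
  then have "?q\<^sup>2 * card (zeros W) + ?q * card ?Q = ?q * card W + ?q\<^sup>2 * card (zeros ?Q)"
    by (simp add: power2_eq_square distrib_left mult.assoc)
  moreover have "card ?Q \<le> ?q\<^sup>2 * card (zeros ?Q)"
    by (rule card_le_card_zeros[OF subspace_perp[OF W]])
  moreover have "?q * card ?Q = p * card ?Q + card ?Q"
    unfolding p(1) by simp
  ultimately have "?q * card W \<le> ?q\<^sup>2 * card (zeros W) + p * card ?Q"
    by linarith
  also have "\<dots> \<le> ?q\<^sup>2 * card (zeros W) + p * ?q ^ (m - s)"
    using card_perp_Int_L_le[OF W] by simp
  finally have "p * (?q\<^sup>2 * N) \<le> p * (?q * card W) + p * ?q ^ (m - s)"
    using N q2(2)[of "card W"] by linarith
  then have "p * (?q\<^sup>2 * N) \<le> p * (?q * card W + ?q ^ (m - s))"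
    by (simp only: distrib_left)
  then show "?q\<^sup>2 * card {w\<in>W. f w = a} \<le> ?q * card W + ?q ^ (m - s)"
    using p(2) unfolding N_def by (simp only: mult_le_cancel1)
qed

text \<open>The zero vector leaves at most \<open>q - 1\<close> vectors, and the
  \<open>q - 1\<close> nonzero values are taken equally often.\<close>

lemma level_set_line_le:
  assumes W: "subspace W" "card W = CARD('a)" and a: "a \<noteq> 0"
  shows "card {w\<in>W. f w = a} \<le> 1"
proof -
  have "0 < card (zeros W)"
    using subspace_0[OF W(1)] f_zero by (auto simp: card_gt_0_iff)
  then have "(CARD('a) - 1) * card {w\<in>W. f w = a} \<le> (CARD('a) - 1) * 1"
    using card_level_set_form[OF W(1) a] W(2) by linarith
  then show ?thesis using q_gt_1 by (simp only: mult_le_cancel1)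
qed

section \<open>Subspaces attaining the bounds\<close>

lemma ex_vector_value: "\<exists>x. f x = b \<and> y 2 x = 1"
proof -
  \<comment> \<open>The first hyperbolic pair gets the coordinates \<open>b\<close> and 1, all
    others are 0. The 1 keeps the vector outside the radical.\<close>
  obtain x where x: "\<And>i. i \<in> {1..m} \<Longrightarrow> y i x = (if i = 1 then b else if i = 2 then 1 else 0)"
    using y_surj[of "\<lambda>i. if i = 1 then b else if i = 2 then 1 else 0"] by blast
  have "f x = (\<Sum>k\<in>{1..s}. if k = 1 then b else 0)"
    unfolding f_eq
  proof (rule sum.cong[OF refl])
    fix k assume "k \<in> {1..s}"
    then have "2 * k \<in> {1..m}" "2 * k - 1 \<in> {1..m}" "2 * k \<noteq> 1"
      using s_less by auto
    then show "y (2 * k - 1) x * y (2 * k) x = (if k = 1 then b else 0)"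
      by (auto simp: x)
  qed
  then have "f x = b" using s_pos by simp
  moreover have "y 2 x = 1" using x[of 2] s_pos s_less by simp
  ultimately show ?thesis by blast
qed

text \<open>The hyperplane is the orthogonal space of a vector \<open>v\<close> with
  \<open>f v = 1\<close>. By \<open>card_perp_anisotropic\<close> one q-th of it are zeros, so every
  other value also gets one q-th.\<close>

lemma ex_hyperplane_level_set:
  assumes a: "a \<noteq> 0"
  shows "\<exists>W. subspace W \<and> card W = CARD('a) ^ (m - 1) \<and> CARD('a) * card {w\<in>W. f w = a} = card W"
proof -
  let ?q = "CARD('a)"
  obtain v where fv: "f v = 1" and v2: "y 2 v = 1" using ex_vector_value by blast
  obtain u where u: "\<And>i. i \<in> {1..m} \<Longrightarrow> y i u = (if i = 1 then 1 else 0)"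
    using y_surj[of "\<lambda>i. if i = 1 then 1 else 0"] by blast
  \<comment> \<open>As \<open>u\<close> is the first coordinate vector,
    \<open>B v u = y 2 v = 1\<close>; hence the orthogonal space of \<open>v\<close> is a true
    hyperplane.\<close>
  have Bvu: "B v u \<noteq> 0"
    using B_single(1)[of 1 u 1 v] u s_pos v2 by simp
  define W where "W = perp UNIV {v}"
  have W: "subspace W" unfolding W_def by (rule subspace_perp[OF subspace_UNIV])
  have "?q * card {x\<in>UNIV. B v x = 0} = CARD('b)"
    by (rule card_level_set_functional[OF subspace_UNIV]) (use Bvu in \<open>auto simp: B_add_right B_scale_right\<close>)
  then have "?q * card W = ?q * ?q ^ (m - 1)"
    using s_less by (simp add: W_def perp_def B_commute card_UNIV_eq power_eq_if)
  then have cW: "card W = ?q ^ (m - 1)" by simp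
  have Z: "?q * card (zeros W) = card W"
    unfolding W_def by (rule card_perp_anisotropic[OF subspace_UNIV]) (simp_all add: fv)
  obtain p where p: "?q = Suc p" "p > 0"
    using q_gt_1 by (metis Suc_lessE One_nat_def)
  have "?q * ((?q - 1) * card {w\<in>W. f w = a} + card (zeros W)) = ?q * card W"
    using card_level_set_form[OF W a] by simp
  then have "p * (?q * card {w\<in>W. f w = a}) + ?q * card (zeros W) = ?q * card W"
    unfolding p(1) by (simp add: algebra_simps)
  then have "p * (?q * card {w\<in>W. f w = a}) = p * card W"
    unfolding Z by (simp add: p(1))
  then have "?q * card {w\<in>W. f w = a} = card W"
    using p(2) by (simp only: mult_cancel1) simp
  with W cW show ?thesis by blast
qed

lemma ex_line_level_set:
  assumes a: "a \<noteq> 0"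
  shows "\<exists>W. subspace W \<and> card W = CARD('a) \<and> 1 \<le> card {w\<in>W. f w = a}"
proof -
  obtain v where v: "f v = a" using ex_vector_value by blast
  define W where "W = span {v}"
  have "independent {v}"
    using v a f_zero by (intro independent_insertI independent_empty) auto
  then have "card W = CARD('a)"
    using card_span_independent[of "{v}"] by (simp add: W_def)
  moreover have "v \<in> {w\<in>W. f w = a}"
    using v by (simp add: W_def span_base)
  then have "1 \<le> card {w\<in>W. f w = a}"
    by (metis Suc_leI card_gt_0_iff empty_iff finite One_nat_def)
  ultimately show ?thesis
    using W_def by auto
qed

text \<open>For \<open>v \<noteq> 0\<close>, division by \<open>v\<^sup>2\<close> would make
  \<open>u / v\<close> a solution of \<open>x\<^sup>2 + x = \<alpha>\<close>.\<close>

lemma anisotropic_plane: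
  assumes \<alpha>: "\<And>x :: 'a. x\<^sup>2 + x \<noteq> \<alpha>" and eq: "u * (u + v) + \<alpha> * v * v = 0"
  shows "u = 0 \<and> v = (0 :: 'a)"
proof -
  have "v = 0"
  proof (rule ccontr)
    assume v: "v \<noteq> 0"
    have "(u / v)\<^sup>2 + u / v + \<alpha> = (u * (u + v) + \<alpha> * v * v) / v\<^sup>2"
      using v by (simp add: field_simps power2_eq_square)
    then have 0: "(u / v)\<^sup>2 + u / v + \<alpha> = 0" using eq by simp
    have "\<alpha> + \<alpha> = (1 + 1) * \<alpha>" unfolding distrib_right by simp
    then have "\<alpha> + \<alpha> = 0" unfolding char2 by simp
    with 0 have "(u / v)\<^sup>2 + u / v = \<alpha>"
      by (metis add_right_cancel)
    with \<alpha> show False by blast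
  qed
  with eq show ?thesis by simp
qed

text \<open>On the subspace below, the first two hyperbolic planes of the form are cut down to the
  anisotropic plane \<open>u\<^sup>2 + u v + \<alpha> v\<^sup>2\<close>, so that the restriction of the form has Type II.\<close>

lemma ex_type_II_level_set:
  assumes a: "a \<noteq> 0" and s2: "2 \<le> s"
    and J: "J \<subseteq> {5..m}" "\<And>k. k \<in> {3..s} \<Longrightarrow> 2 * k - 1 \<in> J \<Longrightarrow> 2 * k \<in> J"
  defines "E \<equiv> (\<lambda>k. 2 * k) ` {3..s}"
  shows "\<exists>W. subspace W \<and> card W = CARD('a) ^ (m - 2 - card J) \<and>
    (CARD('a))\<^sup>2 * card {w\<in>W. f w = a} = CARD('a) * card W + CARD('a) ^ (m - 2 - card (J \<union> E))"
proof -
  let ?q = "CARD('a)"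
  obtain \<alpha> :: 'a where \<alpha>: "\<And>x. x\<^sup>2 + x \<noteq> \<alpha>"
    using exists_not_artin_schreier[OF char2] by blast
  have m5: "5 \<le> m" using s2 s_less by simp
  have E: "E \<subseteq> {5..m}" using s_less by (auto simp: E_def)
  have fin: "finite J" "finite E" using J(1) by (auto simp: E_def intro: finite_subset)
  \<comment> \<open>The relations on \<open>y 2\<close> and \<open>y 3\<close> turn
    \<open>y 1 x * y 2 x + y 3 x * y 4 x\<close> into the anisotropic form in \<open>y 1 x\<close>
    and \<open>y 4 x\<close>. The set \<open>I\<close> is left open because both the wanted subspace
    \<open>W J\<close> and the orthogonal space \<open>W (J \<union> E)\<close> of \<open>T\<close>
    in it have this shape.\<close>
  define W where "W = (\<lambda>I. {x. y 2 x = y 1 x + y 4 x \<and> y 3 x = \<alpha> * y 4 x \<and> (\<forall>i\<in>I. y i x = 0)})"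
  have sub: "subspace (W I)" for I
    by (auto simp: subspace_def W_def y_add y_scale algebra_simps)
  have cardW: "card (W I) = ?q ^ (m - 2 - card I)" if I: "I \<subseteq> {5..m}" for I
  proof -
    define I' where "I' = {1..m} - ({2, 3} \<union> I)"
    have "I' \<subseteq> {1..m}" by (auto simp: I'_def)
    note * = card_coordinate_graph[OF this, of "\<lambda>i g. if i = 2 then g 1 + g 4 else if i = 3 then \<alpha> * g 4 else 0"]
    have I': "{1..m} - I' = insert 2 (insert 3 I)" "1 \<in> I'" "4 \<in> I'" and nI: "2 \<notin> I" "3 \<notin> I"
      using I m5 by (auto simp: I'_def)
    have nI': "i \<noteq> 2" "i \<noteq> 3" if "i \<in> I" for i
      using that nI by auto
    have "{x. \<forall>i\<in>{1..m} - I'. y i x = (if i = 2 then (if 1 \<in> I' then y 1 x else 0) + (if 4 \<in> I' then y 4 x else 0)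
        else if i = 3 then \<alpha> * (if 4 \<in> I' then y 4 x else 0) else 0)} = W I"
      unfolding W_def I'(1) using I'(2,3) nI' by (intro Collect_cong) (simp cong: ball_cong)
    moreover have "card I' = m - 2 - card I"
    proof -
      have fI: "finite I" using I finite_subset by blast
      have "card I' = m - card ({2, 3} \<union> I)"
        unfolding I'_def using I m5 fI by (subst card_Diff_subset) auto
      also have "card ({2, 3} \<union> I) = 2 + card I"
        using nI fI by simp
      finally show ?thesis by simp
    qed
    ultimately show ?thesis using * by simp
  qed
  \<comment> \<open>The totally singular subspace for the translation count. Its orthogonal space in
    \<open>W J\<close> will be \<open>W (J \<union> E)\<close>, where only the anisotropic plane
    survives in \<open>f\<close>, so that the zeros there are exactly \<open>T\<close>.\<close>
  define T where "T = {x. \<forall>i\<in>{1, 2, 3, 4} \<union> (J \<union> E). y i x = 0}"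
  have T: "subspace T" unfolding T_def by (rule subspace_coordinates_vanish)
  have cardT: "card T = ?q ^ (m - 4 - card (J \<union> E))"
  proof -
    have "card ({1, 2, 3, 4} \<union> (J \<union> E)) = card {1, 2, 3, 4 :: nat} + card (J \<union> E)"
      using J(1) E fin by (intro card_Un_disjoint) auto
    moreover have "card T = ?q ^ (m - card ({1, 2, 3, 4} \<union> (J \<union> E)))"
      unfolding T_def by (rule card_coordinates_vanish) (use J(1) E m5 in auto)
    moreover have "card {1, 2, 3, 4 :: nat} = 4" by simp
    ultimately show ?thesis by (simp only: diff_diff_left)
  qed
  have TW: "T \<subseteq> W J" by (auto simp: T_def W_def)
  have even_E: "2 * k \<in> E" if "k \<in> {3..s}" for k
    using that by (auto simp: E_def)
  have f_split: "f x = y 1 x * y 2 x + (y 3 x * y 4 x + (\<Sum>k\<in>{3..s}. y (2 * k - 1) x * y (2 * k) x))" for x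
    unfolding f_eq using sum_split_first_two[OF s2, of "\<lambda>k. y (2 * k - 1) x * y (2 * k) x"] by simp
  have f_W: "f x = y 1 x * (y 1 x + y 4 x) + \<alpha> * y 4 x * y 4 x" if "x \<in> W (J \<union> E)" for x
  proof -
    have "(\<Sum>k\<in>{3..s}. y (2 * k - 1) x * y (2 * k) x) = 0"
      using that even_E by (intro sum.neutral) (auto simp: W_def)
    then show ?thesis using that by (simp add: f_split W_def)
  qed
  have TWE: "T \<subseteq> W (J \<union> E)" by (auto simp: T_def W_def)
  have sing: "f t = 0" if "t \<in> T" for t
    using f_W[of t] that TWE by (auto simp: T_def)
  have zeros_WE: "zeros (W (J \<union> E)) = T"
  proof
    show "zeros (W (J \<union> E)) \<subseteq> T"
    proof
      fix x assume x: "x \<in> zeros (W (J \<union> E))"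
      then have xW: "x \<in> W (J \<union> E)" and fx: "f x = 0" by auto
      have "y 1 x * (y 1 x + y 4 x) + \<alpha> * y 4 x * y 4 x = 0"
        using trans[OF f_W[OF xW, symmetric] fx] .
      then have "y 1 x = 0 \<and> y 4 x = 0"
        by (rule anisotropic_plane[OF \<alpha>])
      then show "x \<in> T" using x by (auto simp: W_def T_def)
    qed
  qed (use TWE sing in auto)
  have perp_T: "perp (W J) T = W (J \<union> E)"
  proof (intro equalityI subsetI)
    fix w assume w: "w \<in> perp (W J) T"
    have "y (2 * k) w = 0" if k: "k \<in> {3..s}" for k
    proof (cases "2 * k \<in> J")
      case True
      then show ?thesis using w by (auto simp: perp_def W_def)
    next
      case False
      \<comment> \<open>The condition on \<open>J\<close> leaves the odd partner unconstrained as
        well, so the coordinate vector of \<open>2 * k - 1\<close> lies in \<open>T\<close>, and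
        pairing with it forces \<open>y (2 * k) w = 0\<close>.\<close>
      then have notJ: "2 * k - 1 \<notin> J" using J(2) k by blast
      have notE: "2 * k - 1 \<notin> E"
      proof
        assume "2 * k - 1 \<in> E"
        then obtain j where "2 * k - 1 = 2 * j" unfolding E_def by blast
        then show False using k by simp presburger
      qed
      obtain t where t: "\<And>i. i \<in> {1..m} \<Longrightarrow> y i t = (if i = 2 * k - 1 then 1 else 0)"
        using y_surj[of "\<lambda>i. if i = 2 * k - 1 then 1 else 0"] by blast
      have "t \<in> T"
        unfolding T_def
      proof (intro CollectI ballI)
        fix i assume i: "i \<in> {1, 2, 3, 4} \<union> (J \<union> E)"
        then have "i \<in> {1..m}" using J(1) E m5 by auto
        moreover have "i \<noteq> 2 * k - 1" using i notJ notE k by auto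
        ultimately show "y i t = 0" by (simp add: t)
      qed
      then have "B w t = 0" using w by (auto simp: perp_def)
      moreover have "B w t = y (2 * k) w"
        using B_single(1)[of k t "2 * k - 1" w] k t by simp
      ultimately show ?thesis by simp
    qed
    then show "w \<in> W (J \<union> E)"
      using w by (auto simp: perp_def W_def E_def)
  next
    fix w assume w: "w \<in> W (J \<union> E)"
    have "B w t = 0" if t: "t \<in> T" for t
    proof -
      have t_plane: "y 1 t = 0" "y 2 t = 0" "y 3 t = 0" "y 4 t = 0"
        using t by (auto simp: T_def)
      have "(\<Sum>k\<in>{3..s}. y (2 * k - 1) w * y (2 * k) t + y (2 * k) w * y (2 * k - 1) t) = 0"
        using w t even_E by (intro sum.neutral) (auto simp: W_def T_def)
      then show ?thesis
        unfolding B_def sum_split_first_two[OF s2, of "\<lambda>k. y (2 * k - 1) w * y (2 * k) t + y (2 * k) w * y (2 * k - 1) t"]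
        by (simp add: t_plane t_plane(1)[unfolded One_nat_def])
    qed
    then show "w \<in> perp (W J) T"
      using w by (auto simp: perp_def W_def)
  qed
  have Z: "?q * card (zeros (W J)) + card (W (J \<union> E)) = card (W J) + ?q * card T"
    using card_zeros_singular_subspace[OF sub T TW sing] by (simp add: perp_T zeros_WE)
  \<comment> \<open>\<open>W (J \<union> E)\<close> has just the two plane coordinates more than
    \<open>T\<close>: here \<open>card_le_card_zeros\<close> holds with equality.\<close>
  have cQ: "card (W (J \<union> E)) = ?q\<^sup>2 * card T"
  proof -
    have "card (J \<union> E) \<le> card {5..m}" using J(1) E by (intro card_mono) auto
    then have "m - 2 - card (J \<union> E) = 2 + (m - 4 - card (J \<union> E))" using m5 by simp
    then show ?thesis using cardW[of "J \<union> E"] J(1) E cardT by (simp add: power_add power2_eq_square)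
  qed
  obtain p where p: "?q = Suc p" "p > 0"
    using q_gt_1 by (metis Suc_lessE One_nat_def)
  define N where "N = card {w\<in>W J. f w = a}"
  have N: "p * N + card (zeros (W J)) = card (W J)"
    using card_level_set_form[OF sub a, of J] p by (simp add: N_def)
  have "p * (?q\<^sup>2 * N) + ?q * (?q * card (zeros (W J))) = ?q\<^sup>2 * card (W J)"
    unfolding N[symmetric] by (simp add: power2_eq_square algebra_simps)
  moreover have "?q * (?q * card (zeros (W J))) + ?q * card (W (J \<union> E)) = ?q * card (W J) + card (W (J \<union> E))"
    using arg_cong[OF Z, of "\<lambda>x. ?q * x"] cQ by (simp add: power2_eq_square algebra_simps)
  ultimately have "p * (?q\<^sup>2 * N) = p * (?q * card (W J) + card (W (J \<union> E)))"
    unfolding p(1) by (simp add: power2_eq_square algebra_simps)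
  then have "?q\<^sup>2 * N = ?q * card (W J) + card (W (J \<union> E))"
    using p(2) by (simp only: mult_cancel1) simp
  then show ?thesis
    using sub[of J] cardW[of J] cardW[of "J \<union> E"] J(1) E unfolding N_def by auto
qed

end

section \<open>The trace form\<close>

lemma power_card_field: "(x :: 'a::{field,finite}) ^ CARD('a) = x"
proof (cases "x = 0")
  case False
  have "bij_betw ((*) x) (UNIV - {0}) (UNIV - {0})"
    by (rule bij_betw_byWitness[where f' = "\<lambda>y. y / x"]) (use False in auto)
  then have "(\<Prod>y\<in>UNIV - {0}. x * y) = (\<Prod>y\<in>UNIV - {0}. y)"
    by (rule prod.reindex_bij_betw)
  then have "x ^ (CARD('a) - 1) * (\<Prod>y\<in>UNIV - {0}. y) = (\<Prod>y\<in>UNIV - {0}. y)"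
    by (simp add: prod.distrib)
  moreover have "(\<Prod>y\<in>UNIV - {0 :: 'a}. y) \<noteq> 0"
    by simp
  ultimately have "x ^ (CARD('a) - 1) = 1"
    by simp
  then have "x * x ^ (CARD('a) - 1) = x"
    by simp
  then show ?thesis
    using card_field_ge_2[where 'a = 'a] by (simp flip: power_Suc)
qed simp

text \<open>Translation by 1 permutes the field, so comparing the sums of all elements shows that
  the order of the field is 0 in it; a vanishing power of 2 makes 2 itself vanish.\<close>

lemma char2_of_card:
  assumes "CARD('a::{field,finite}) = 2 ^ e"
  shows "(1 :: 'a) + 1 = 0"
proof -
  have "bij (\<lambda>x :: 'a. x + 1)"
    by (rule bij_betw_byWitness[where f' = "\<lambda>x. x - 1"]) auto
  then have "(\<Sum>x\<in>UNIV. x + 1) = (\<Sum>x :: 'a\<in>UNIV. x)"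
    by (rule sum.reindex_bij_betw)
  then have "of_nat (CARD('a)) = (0 :: 'a)"
    by (simp add: sum.distrib)
  then have "(2 :: 'a) ^ e = 0"
    by (simp add: assms)
  then show ?thesis by simp
qed

locale char2_extension =
  fixes \<iota> :: "'a::{field,finite} \<Rightarrow> 'b::{field,finite}" and m e :: nat
  assumes embedding: "field_embedding \<iota>"
    and card_a: "CARD('a) = 2 ^ e"
    and card_b: "CARD('b) = CARD('a) ^ m"
    and m_pos: "0 < m"
begin

lemma emb_add: "\<iota> (x + y) = \<iota> x + \<iota> y"
  and emb_mult: "\<iota> (x * y) = \<iota> x * \<iota> y"
  and emb_one: "\<iota> 1 = 1"
  using embedding by (auto simp: field_embedding_def)

lemma emb_zero: "\<iota> 0 = 0"
  using emb_add[of 0 0] by (metis add_0_left add_cancel_right_right)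

lemma emb_inject: "\<iota> x = \<iota> y \<longleftrightarrow> x = y"
proof
  assume eq: "\<iota> x = \<iota> y"
  have "\<iota> (x - y) = 0"
    using emb_add[of "x - y" y] eq by simp
  moreover have "\<iota> (x - y) * \<iota> (inverse (x - y)) = 1" if "x \<noteq> y"
    using that by (simp flip: emb_mult add: emb_one)
  ultimately show "x = y" by auto
qed simp

lemma emb_power: "\<iota> (x ^ n) = \<iota> x ^ n"
  by (induction n) (simp_all add: emb_one emb_mult)

lemma emb_power_q: "\<iota> c ^ CARD('a) ^ i = \<iota> c"
  by (induction i) (simp_all add: power_mult power_card_field flip: emb_power)

sublocale finite_vector_space "ext_scale \<iota>"
  by unfold_locales (simp_all add: ext_scale_def emb_add emb_mult emb_one algebra_simps)

lemma char_b: "CHAR('b) = 2"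
proof -
  have "\<iota> (1 + 1) = 0"
    unfolding char2_of_card[OF card_a] by (rule emb_zero)
  then have "(1 :: 'b) + 1 = 0"
    unfolding emb_add emb_one .
  then have "of_nat 2 = (0 :: 'b)"
    by simp
  then have "CHAR('b) dvd 2"
    unfolding of_nat_eq_0_iff_char_dvd .
  moreover have "CHAR('b) \<noteq> 1"
    by simp
  ultimately show ?thesis
    using two_is_prime_nat prime_nat_iff by blast
qed

lemma frobenius_add: "((x :: 'b) + y) ^ CARD('a) ^ i = x ^ CARD('a) ^ i + y ^ CARD('a) ^ i"
  by (rule freshmans_dream'[where n = "e * i"]) (simp_all add: char_b card_a power_mult)

lemma frobenius_sum: "(\<Sum>k\<in>A. g k :: 'b) ^ CARD('a) = (\<Sum>k\<in>A. g k ^ CARD('a))"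
  by (rule freshmans_dream_sum'[where n = e]) (simp_all add: char_b card_a)

text \<open>The polynomial \<open>X ^ q - X\<close> has at most q roots, and the q elements of the
  embedded base field are roots.\<close>

lemma fixed_by_frobenius_iff: "(x :: 'b) ^ CARD('a) = x \<longleftrightarrow> x \<in> range \<iota>"
proof -
  let ?p = "monom 1 (CARD('a)) - monom 1 1 :: 'b poly"
  have q: "CARD('a) \<ge> 2" by (rule card_field_ge_2)
  have "coeff ?p (CARD('a)) = 1"
    using q by simp
  then have p0: "?p \<noteq> 0"
    by (metis coeff_0 zero_neq_one)
  have "degree ?p \<le> CARD('a)"
    using q by (intro degree_diff_le degree_monom_le[THEN order_trans]) auto
  then have "card {x. poly ?p x = 0} \<le> CARD('a)"
    using card_poly_roots_bound[OF p0] by linarith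
  moreover have roots: "poly ?p x = 0 \<longleftrightarrow> x ^ CARD('a) = x" for x
    by (simp add: poly_monom)
  ultimately have "card {x :: 'b. x ^ CARD('a) = x} \<le> card (range \<iota>)"
    by (simp add: card_image inj_on_def emb_inject)
  moreover have "range \<iota> \<subseteq> {x. x ^ CARD('a) = x}"
    using emb_power_q[of _ 1] by auto
  ultimately have "range \<iota> = {x. x ^ CARD('a) = x}"
    by (intro card_seteq) auto
  then show ?thesis by auto
qed

text \<open>This justifies the definite description in \<open>field_trace\<close>: as
  \<open>x ^ (q ^ m) = x\<close>, raising to the power q permutes the conjugates cyclically, so
  their sum is fixed and lies in the range of \<open>\<iota>\<close>.\<close>

lemma emb_trace: "\<iota> (field_trace \<iota> m x) = (\<Sum>i<m. x ^ (CARD('a) ^ i))"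
proof -
  have "(\<Sum>i<m. x ^ (CARD('a) ^ i)) ^ CARD('a) = (\<Sum>i<m. x ^ (CARD('a) ^ Suc i))"
    by (simp add: frobenius_sum power_mult[symmetric] mult.commute)
  also have "\<dots> = (\<Sum>i<m. x ^ (CARD('a) ^ i))"
    using sum.lessThan_Suc_shift[of "\<lambda>i. x ^ (CARD('a) ^ i)" m] power_card_field[of x]
    by (simp add: card_b)
  finally obtain c where c: "\<iota> c = (\<Sum>i<m. x ^ (CARD('a) ^ i))"
    using fixed_by_frobenius_iff by (metis imageE)
  show ?thesis
    unfolding field_trace_def
    by (rule theI[of _ c]) (use c emb_inject in metis)+
qed

lemma trace_add: "field_trace \<iota> m (x + y) = field_trace \<iota> m x + field_trace \<iota> m y"
  by (subst emb_inject[symmetric]) (simp add: emb_add emb_trace frobenius_add sum.distrib)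

lemma trace_scale: "field_trace \<iota> m (ext_scale \<iota> c x) = c * field_trace \<iota> m x"
  by (subst emb_inject[symmetric])
     (simp add: emb_mult emb_trace ext_scale_def power_mult_distrib emb_power_q sum_distrib_left)

text \<open>The conjugate sum is a nonzero polynomial of degree at most \<open>q ^ (m - 1)\<close>,
  so it cannot vanish at all \<open>q ^ m\<close> elements.\<close>

lemma ex_trace_nonzero: "\<exists>x. field_trace \<iota> m x \<noteq> 0"
proof (rule ccontr)
  assume "\<not> ?thesis"
  then have tr0: "(\<Sum>i<m. x ^ (CARD('a) ^ i)) = 0" for x :: 'b
    using emb_trace[of x] by (simp add: emb_zero)
  let ?p = "\<Sum>i<m. monom 1 (CARD('a) ^ i) :: 'b poly"
  have q: "CARD('a) \<ge> 2" by (rule card_field_ge_2)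
  have "coeff ?p (CARD('a) ^ 0) = (\<Sum>i<m. if i = 0 then 1 else 0)"
    unfolding coeff_sum coeff_monom using q by (intro sum.cong) auto
  also have "\<dots> = 1" using m_pos by simp
  finally have p0: "?p \<noteq> 0"
    by (metis coeff_0 zero_neq_one)
  have "degree ?p \<le> CARD('a) ^ (m - 1)"
    using q by (intro degree_sum_le order_trans[OF degree_monom_le] power_increasing) auto
  moreover have "{x. poly ?p x = 0} = UNIV"
    using tr0 by (simp add: poly_sum poly_monom)
  ultimately have "CARD('b) \<le> CARD('a) ^ (m - 1)"
    using card_poly_roots_bound[OF p0] by simp
  also have "\<dots> < CARD('a) ^ m"
    using q m_pos by (intro power_strict_increasing) auto
  finally show False by (simp add: card_b)
qed

section \<open>Duality with respect to the trace form\<close>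

definition trace_form :: "'b \<Rightarrow> 'b \<Rightarrow> 'a" where
  "trace_form x d = field_trace \<iota> m (x * d)"

lemma trace_form_add_left: "trace_form (x + x') d = trace_form x d + trace_form x' d"
  and trace_form_add_right: "trace_form x (d + d') = trace_form x d + trace_form x d'"
  by (simp_all add: trace_form_def algebra_simps trace_add)

lemma trace_form_scale_left: "trace_form (ext_scale \<iota> c x) d = c * trace_form x d"
  and trace_form_scale_right: "trace_form x (ext_scale \<iota> c d) = c * trace_form x d"
  using trace_scale[of c "x * d"] by (simp_all add: trace_form_def ext_scale_def mult_ac)

lemma trace_form_commute: "trace_form x d = trace_form d x"
  by (simp add: trace_form_def mult.commute)

lemma trace_form_nondegenerate: "(\<And>d. trace_form x d = 0) \<Longrightarrow> x = 0"
proof (rule ccontr)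
  assume 0: "\<And>d. trace_form x d = 0" and "x \<noteq> 0"
  obtain t where t: "field_trace \<iota> m t \<noteq> 0"
    using ex_trace_nonzero by blast
  have "trace_form x (t / x) = field_trace \<iota> m t"
    using \<open>x \<noteq> 0\<close> by (simp add: trace_form_def)
  with t 0[of "t / x"] show False by simp
qed

definition dual :: "'b set \<Rightarrow> 'b set" where
  "dual X = {d. \<forall>x\<in>X. trace_form x d = 0}"

lemma subspace_dual: "subspace (dual X)"
proof -
  have "trace_form x 0 = 0" for x
    using trace_form_scale_right[of x 0 0] by simp
  then show ?thesis
    by (auto simp: subspace_def dual_def trace_form_add_right trace_form_scale_right)
qed

text \<open>This is \<open>card_annihilator\<close> against the whole space; nondegeneracy reduces
  the other annihilator to 0.\<close>

lemma card_dual: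
  assumes "subspace X"
  shows "card X * card (dual X) = CARD('b)"
proof -
  have "card X * card {y\<in>UNIV. \<forall>x\<in>X. trace_form x y = 0} = CARD('b) * card {x\<in>X. \<forall>y\<in>UNIV. trace_form x y = 0}"
    by (rule card_annihilator[OF assms subspace_UNIV])
       (simp_all add: trace_form_add_left trace_form_add_right trace_form_scale_left trace_form_scale_right)
  moreover have "{x\<in>X. \<forall>y\<in>UNIV. trace_form x y = 0} = {0}"
    using trace_form_nondegenerate subspace_0[OF assms]
    by (auto simp: trace_form_commute[of 0] subspace_0[OF subspace_dual, of UNIV, unfolded dual_def, simplified])
  ultimately show ?thesis by (simp add: dual_def)
qed

lemma dual_dual:
  assumes "subspace X"
  shows "dual (dual X) = X"
proof -
  have sub: "X \<subseteq> dual (dual X)"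
    by (auto simp: dual_def trace_form_commute)
  have "card (dual X) * card (dual (dual X)) = card (dual X) * card X"
    using card_dual[OF assms] card_dual[OF subspace_dual, of X] by (simp add: mult.commute)
  then have "card (dual (dual X)) = card X"
    using card_pos_subspace[OF subspace_dual, of X] unfolding mult_cancel1 by linarith
  with sub show ?thesis
    by (intro card_seteq[symmetric]) auto
qed

end

section \<open>The weight hierarchy\<close>

lemma finite_vector_space_word:
  "finite_vector_space (word_scale :: 'a::{field,finite} \<Rightarrow> ('i::finite \<Rightarrow> 'a) \<Rightarrow> 'i \<Rightarrow> 'a)"
  by unfold_locales (auto simp: word_scale_def fun_eq_iff algebra_simps)

section \<open>Subcodes, their supports and subspaces of the extension field\<close>

context char2_extension
begin

interpretation word: finite_vector_space "word_scale :: 'a \<Rightarrow> ('b \<Rightarrow> 'a) \<Rightarrow> 'b \<Rightarrow> 'a"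
  by (rule finite_vector_space_word)

definition trace_word :: "'b set \<Rightarrow> 'b \<Rightarrow> 'b \<Rightarrow> 'a" where
  "trace_word D x = (\<lambda>d. if d \<in> D then trace_form x d else 0)"

lemma trace_code_eq: "trace_code \<iota> m D = range (trace_word D)"
  unfolding trace_code_def trace_word_def[abs_def] trace_form_def ..

lemma trace_word_add: "trace_word D (x + x') = trace_word D x + trace_word D x'"
  by (auto simp: trace_word_def fun_eq_iff trace_form_add_left)

lemma trace_word_scale: "trace_word D (ext_scale \<iota> c x) = word_scale c (trace_word D x)"
  by (auto simp: trace_word_def fun_eq_iff trace_form_scale_left word_scale_def)

lemma trace_word_zero: "trace_word D 0 = 0"
  using trace_word_add[of D 0 0] by simp

lemma code_supp_trace_word: "code_supp (trace_word D ` X) = D - dual X"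
  by (auto simp: code_supp_def trace_word_def dual_def)

lemma subspace_trace_word_image: "subspace X \<Longrightarrow> word.subspace (trace_word D ` X)"
  unfolding word.subspace_def subspace_def
  by (auto simp flip: trace_word_add trace_word_scale intro: image_eqI[where x = 0] simp: trace_word_zero)

lemma subspace_trace_word_vimage: "word.subspace H \<Longrightarrow> subspace (trace_word D -` H)"
  unfolding word.subspace_def subspace_def
  by (auto simp: trace_word_add trace_word_scale trace_word_zero)

lemma code_dim_eq_iff:
  assumes "word.subspace H"
  shows "code_dim H = r \<longleftrightarrow> card H = CARD('a) ^ r"
  using word.card_subspace_eq_power_dim[OF assms] card_field_ge_2[where 'a = 'a]
  by (simp add: code_dim_def)

text \<open>If \<open>trace_word D v = 0\<close> with \<open>v \<noteq> 0\<close>, then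
  \<open>D\<close> lies in the dual of the line spanned by \<open>v\<close>, which is a
  hyperplane.\<close>

lemma inj_trace_word:
  assumes "\<And>W. subspace W \<Longrightarrow> card W = CARD('a) ^ (m - 1) \<Longrightarrow> \<not> D \<subseteq> W"
  shows "inj (trace_word D)"
proof (rule injI, rule ccontr)
  fix x x' assume eq: "trace_word D x = trace_word D x'" and "x \<noteq> x'"
  define v where "v = x - x'"
  have v: "v \<noteq> 0" using \<open>x \<noteq> x'\<close> by (simp add: v_def)
  have "trace_word D v + trace_word D x' = trace_word D x'"
    unfolding trace_word_add[symmetric] by (simp add: v_def eq)
  then have v0: "trace_word D v = 0" by simp
  have "independent {v}"
    using v by (intro independent_insertI independent_empty) auto
  then have "card (span {v}) = CARD('a)"
    using card_span_independent[of "{v}"] by simp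
  then have "CARD('a) * card (dual (span {v})) = CARD('a) * CARD('a) ^ (m - 1)"
    using card_dual[OF subspace_span, of "{v}"] m_pos by (simp add: card_b power_eq_if)
  then have "card (dual (span {v})) = CARD('a) ^ (m - 1)"
    by simp
  moreover have "D \<subseteq> dual (span {v})"
  proof
    fix d assume "d \<in> D"
    then have "trace_form v d = 0"
      using fun_cong[OF v0, of d] by (simp add: trace_word_def)
    then show "d \<in> dual (span {v})"
      by (auto simp: dual_def span_singleton trace_form_scale_left)
  qed
  ultimately show False
    using assms[OF subspace_dual] by blast
qed

lemma code_dim_trace_code:
  assumes "inj (trace_word D)"
  shows "code_dim (trace_code \<iota> m D) = m"
  unfolding trace_code_eq
  using code_dim_eq_iff[OF subspace_trace_word_image[OF subspace_UNIV, of D], of m] assms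
  by (simp add: card_image card_b)

text \<open>Subcodes of dimension \<open>r\<close> correspond to subspaces \<open>X\<close> of order
  \<open>q ^ r\<close>, and these by duality to subspaces of codimension \<open>r\<close>. The
  support has \<open>card D - card (dual X \<inter> D)\<close> positions, so minimising it means
  maximising the intersection, and \<open>N\<close> is that maximum.\<close>

lemma gen_hamming_weight_trace_code:
  assumes inj: "inj (trace_word D)" and r: "r \<le> m"
    and le: "\<And>W. subspace W \<Longrightarrow> card W = CARD('a) ^ (m - r) \<Longrightarrow> card (W \<inter> D) \<le> N"
    and ex: "\<exists>W. subspace W \<and> card W = CARD('a) ^ (m - r) \<and> N \<le> card (W \<inter> D)"
  shows "int (gen_hamming_weight (trace_code \<iota> m D) r) = int (card D) - int N"
proof -
  let ?C = "trace_code \<iota> m D" and ?q = "CARD('a)"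
  let ?M = "{card (code_supp H) | H. H \<subseteq> ?C \<and> module.subspace word_scale H \<and> code_dim H = r}"
  have q: "?q \<ge> 2" by (rule card_field_ge_2)
  have split: "?q ^ m = ?q ^ r * ?q ^ (m - r)"
    using r by (simp flip: power_add)
  have card_supp: "card (D - dual X) = card D - card (dual X \<inter> D)" for X
    by (simp add: card_Diff_subset_Int Int_commute)
  obtain W where W: "subspace W" "card W = ?q ^ (m - r)" "N \<le> card (W \<inter> D)"
    using ex by blast
  have WN: "card (W \<inter> D) = N" using le[OF W(1,2)] W(3) by simp
  have "Min ?M = card D - N"
  proof (rule Min_eqI)
    show "finite ?M"
      by (rule finite_subset[of _ "(card \<circ> code_supp) ` UNIV"]) auto
  next
    fix n assume "n \<in> ?M"
    then obtain H where H: "H \<subseteq> ?C" "word.subspace H" "code_dim H = r" "n = card (code_supp H)"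
      by blast
    define X where "X = trace_word D -` H"
    have X: "subspace X" unfolding X_def by (rule subspace_trace_word_vimage[OF H(2)])
    have HX: "H = trace_word D ` X"
      using H(1) by (auto simp: X_def trace_code_eq)
    have "card X = ?q ^ r"
      using code_dim_eq_iff[OF H(2)] H(3) card_image[OF inj_on_subset[OF inj], of X] HX by simp
    then have "card (dual X) = ?q ^ (m - r)"
      using card_dual[OF X] q by (simp add: card_b split)
    then have "card (dual X \<inter> D) \<le> N"
      by (rule le[OF subspace_dual])
    then show "card D - N \<le> n"
      by (simp add: H(4) HX code_supp_trace_word card_supp)
  next
    \<comment> \<open>The minimum is attained by the subcode of \<open>dual W\<close>, since
      \<open>dual (dual W) = W\<close>.\<close>
    define H where "H = trace_word D ` dual W"
    have sub: "word.subspace H"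
      unfolding H_def by (rule subspace_trace_word_image[OF subspace_dual])
    have "card (dual W) * ?q ^ (m - r) = ?q ^ r * ?q ^ (m - r)"
      using card_dual[OF W(1)] by (simp add: W(2) card_b split mult.commute)
    then have "card (dual W) = ?q ^ r"
      using q by simp
    then have "card H = ?q ^ r"
      unfolding H_def using card_image[OF inj_on_subset[OF inj], of "dual W"] by simp
    then have "code_dim H = r"
      using code_dim_eq_iff[OF sub] by simp
    moreover have "card (code_supp H) = card D - N"
      unfolding H_def code_supp_trace_word card_supp by (simp add: dual_dual[OF W(1)] WN)
    moreover have "H \<subseteq> ?C"
      by (auto simp: H_def trace_code_eq)
    ultimately show "card D - N \<in> ?M"
      using sub by (intro CollectI exI[of _ H]) auto
  qed
  \<comment> \<open>This inequality makes the truncated difference agree with the integer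
    one.\<close>
  moreover have "N \<le> card D"
    unfolding WN[symmetric] by (rule card_mono) auto
  ultimately show ?thesis
    by (simp add: gen_hamming_weight_def of_nat_diff)
qed

end

context type_I_space
begin

text \<open>A hyperplane containing the level set would give
  \<open>q * q ^ (m - 1) \<le> q ^ (m - 1) + q ^ (m - s)\<close>, impossible for
  \<open>s \<ge> 2\<close> or \<open>q \<ge> 3\<close>. In the excluded case \<open>s = 1\<close>,
  \<open>q = 2\<close> the equation \<open>y 1 x * y 2 x = 1\<close> puts the level set into the
  hyperplane \<open>y 1 x = y 2 x\<close>.\<close>

lemma level_set_not_subset_hyperplane:
  assumes a: "a \<noteq> 0" and W: "subspace W" "card W = CARD('a) ^ (m - 1)"
    and q: "s = 1 \<Longrightarrow> CARD('a) \<noteq> 2"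
  shows "\<not> {x. f x = a} \<subseteq> W"
proof
  let ?q = "CARD('a)"
  assume "{x. f x = a} \<subseteq> W"
  then have "{w\<in>W. f w = a} = {x. f x = a}" by auto
  then have "?q * card {x. f x = a} \<le> ?q ^ (m - 1)"
    using level_set_hyperplane_le[OF W a] W(2) by simp
  moreover have "?q * (card {x. f x = a} + ?q ^ (m - s - 1)) = ?q * ?q ^ (m - 1)"
    by (simp only: card_level_set_UNIV[OF a])
  then have "?q * card {x. f x = a} + ?q ^ (m - s) = ?q * ?q ^ (m - 1)"
    using s_less by (simp add: distrib_left Suc_diff_Suc flip: power_Suc)
  ultimately have le: "?q * ?q ^ (m - 1) \<le> ?q ^ (m - 1) + ?q ^ (m - s)"
    by linarith
  show False
  proof (cases "s = 1")
    case True
    then have "3 \<le> ?q" using q q_gt_1 by linarith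
    then have "3 * ?q ^ (m - 1) \<le> ?q * ?q ^ (m - 1)" by (rule mult_le_mono1)
    moreover have "0 < ?q ^ (m - 1)" by simp
    ultimately show False using le unfolding True by linarith
  next
    case False
    have "?q ^ (m - s) < ?q ^ (m - 1)"
      using q_gt_1 s_pos s_less False by (intro power_strict_increasing) auto
    moreover have "2 * ?q ^ (m - 1) \<le> ?q * ?q ^ (m - 1)"
      using q_gt_1 by (intro mult_le_mono1) simp
    ultimately show False using le by linarith
  qed
qed

end

section \<open>Coordinates for a form equivalent to Type I\<close>

context char2_extension
begin

lemma coord_add:
  "is_basis \<iota> m \<epsilon> \<Longrightarrow> coord \<iota> m \<epsilon> (x + z) i = coord \<iota> m \<epsilon> x i + coord \<iota> m \<epsilon> z i"
  by (simp add: coord_def is_basis_def representation_add)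

lemma coord_scale:
  "is_basis \<iota> m \<epsilon> \<Longrightarrow> coord \<iota> m \<epsilon> (ext_scale \<iota> c x) i = c * coord \<iota> m \<epsilon> x i"
  by (simp add: coord_def is_basis_def representation_scale)

lemma coord_zero: "is_basis \<iota> m \<epsilon> \<Longrightarrow> coord \<iota> m \<epsilon> 0 i = 0"
  using coord_scale[of \<epsilon> 0 0 i] by simp

lemma coord_inject:
  assumes \<epsilon>: "is_basis \<iota> m \<epsilon>" and eq: "\<And>i. i \<in> {1..m} \<Longrightarrow> coord \<iota> m \<epsilon> x i = coord \<iota> m \<epsilon> z i"
  shows "x = z"
proof -
  have repr: "(\<Sum>b\<in>\<epsilon> ` {1..m}. ext_scale \<iota> (representation (\<epsilon> ` {1..m}) v b) b) = v" for v
    using \<epsilon> by (intro sum_representation_eq) (auto simp: is_basis_def)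
  have "representation (\<epsilon> ` {1..m}) x b = representation (\<epsilon> ` {1..m}) z b" if "b \<in> \<epsilon> ` {1..m}" for b
    using that eq by (auto simp: coord_def)
  then have "(\<Sum>b\<in>\<epsilon> ` {1..m}. ext_scale \<iota> (representation (\<epsilon> ` {1..m}) x b) b)
      = (\<Sum>b\<in>\<epsilon> ` {1..m}. ext_scale \<iota> (representation (\<epsilon> ` {1..m}) z b) b)"
    by (intro sum.cong) auto
  then show ?thesis by (simp only: repr)
qed

lemma coord_sum_basis:
  assumes \<epsilon>: "is_basis \<iota> m \<epsilon>" and i: "i \<in> {1..m}"
  shows "coord \<iota> m \<epsilon> (\<Sum>j\<in>{1..m}. ext_scale \<iota> (c j) (\<epsilon> j)) i = c i"
proof -
  have "coord \<iota> m \<epsilon> (\<Sum>j\<in>A. ext_scale \<iota> (c j) (\<epsilon> j)) i = (\<Sum>j\<in>A. c j * coord \<iota> m \<epsilon> (\<epsilon> j) i)"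
    if "finite A" for A
    using that by induction (simp_all add: coord_zero[OF \<epsilon>] coord_add[OF \<epsilon>] coord_scale[OF \<epsilon>])
  then have "coord \<iota> m \<epsilon> (\<Sum>j\<in>{1..m}. ext_scale \<iota> (c j) (\<epsilon> j)) i
      = (\<Sum>j\<in>{1..m}. c j * coord \<iota> m \<epsilon> (\<epsilon> j) i)"
    by blast
  also have "\<dots> = (\<Sum>j\<in>{1..m}. if j = i then c j else 0)"
  proof (rule sum.cong[OF refl])
    fix j assume j: "j \<in> {1..m}"
    have "coord \<iota> m \<epsilon> (\<epsilon> j) i = (if \<epsilon> j = \<epsilon> i then 1 else 0)"
      unfolding coord_def using \<epsilon> j by (subst representation_basis) (auto simp: is_basis_def)
    moreover have "\<epsilon> j = \<epsilon> i \<longleftrightarrow> j = i"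
      using \<epsilon> i j by (auto simp: is_basis_def inj_on_eq_iff)
    ultimately show "c j * coord \<iota> m \<epsilon> (\<epsilon> j) i = (if j = i then c j else 0)" by simp
  qed
  also have "\<dots> = c i" using i by simp
  finally show ?thesis .
qed

text \<open>The required coordinates of \<open>x\<close> are the basis coordinates of its preimage
  under the linear bijection \<open>T\<close> of the equivalence.\<close>

lemma type_I_space_of_equivalent:
  assumes \<epsilon>: "is_basis \<iota> m \<epsilon>" and s: "1 \<le> s" "2 * s < m"
    and equiv: "qf_equivalent \<iota> f (type_I_form \<iota> m \<epsilon> s)"
  shows "\<exists>y. type_I_space (ext_scale \<iota>) y m s f"
proof -
  obtain T where T: "Vector_Spaces.linear (ext_scale \<iota>) (ext_scale \<iota>) T" "bij T" "\<And>x. f (T x) = type_I_form \<iota> m \<epsilon> s x"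
    using equiv unfolding qf_equivalent_def by blast
  interpret T: Vector_Spaces.linear "ext_scale \<iota>" "ext_scale \<iota>" T by (rule T(1))
  define S where "S = inv T"
  have TS: "T (S x) = x" and ST: "S (T x) = x" for x
    using T(2) by (simp_all add: S_def bij_is_surj surj_f_inv_f bij_is_inj inv_f_f)
  have S_add: "S (x + z) = S x + S z" for x z
    using ST[of "S x + S z"] by (simp add: T.add TS)
  have S_scale: "S (ext_scale \<iota> c x) = ext_scale \<iota> c (S x)" for c x
    using ST[of "ext_scale \<iota> c (S x)"] by (simp add: T.scale TS)
  have "type_I_space (ext_scale \<iota>) (\<lambda>i x. coord \<iota> m \<epsilon> (S x) i) m s f"
  proof
    show "\<exists>x. \<forall>i\<in>{1..m}. coord \<iota> m \<epsilon> (S x) i = d i" for d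
      using coord_sum_basis[OF \<epsilon>] by (intro exI[of _ "T (\<Sum>j\<in>{1..m}. ext_scale \<iota> (d j) (\<epsilon> j))"]) (simp add: ST)
    show "x = z" if "\<And>i. i \<in> {1..m} \<Longrightarrow> coord \<iota> m \<epsilon> (S x) i = coord \<iota> m \<epsilon> (S z) i" for x z
      using coord_inject[OF \<epsilon> that] TS by metis
    show "f x = (\<Sum>k = 1..s. coord \<iota> m \<epsilon> (S x) (2 * k - 1) * coord \<iota> m \<epsilon> (S x) (2 * k))" for x
      using T(3)[of "S x"] by (simp add: TS type_I_form_def)
  qed (use s char2_of_card[OF card_a] in \<open>auto simp: S_add S_scale coord_add[OF \<epsilon>] coord_scale[OF \<epsilon>]\<close>)
  then show ?thesis by blast
qed

end

text \<open>The dimension statement shows that \<open>r\<close> runs through the whole weight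
  hierarchy. For \<open>s = 0\<close> the set \<open>D\<close> is empty, and for
  \<open>s = 1\<close>, \<open>q = 2\<close> it lies in a hyperplane, so that the dimension drops
  below \<open>m\<close>. The third clause asks for \<open>2 \<le> s\<close>: for
  \<open>s = 1\<close> no subspace carries a Type II restriction, and the term
  \<open>q ^ (m - r - 2)\<close> does not occur.\<close>

theorem theorem4:
  fixes \<iota> :: "'a::{field,finite} \<Rightarrow> 'b::{field,finite}"
    and \<epsilon> :: "nat \<Rightarrow> 'b"
    and f :: "'b \<Rightarrow> 'a"
    and a :: 'a
    and q m s e :: nat
  defines "D \<equiv> {x. f x = a}"
  defines "C \<equiv> trace_code \<iota> m D"
  assumes "0 < e" and "q = 2 ^ e" and "CARD('a) = q"
    and "0 < m" and "CARD('b) = q ^ m"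
    and "field_embedding \<iota>"
    and "is_basis \<iota> m \<epsilon>"
    and "a \<noteq> 0"
    and "quadratic_form \<iota> m \<epsilon> f"
    and "qf_degenerate f"
    and "qf_rank \<iota> m f = 2 * s"
    and "2 * s < m"
    and "qf_equivalent \<iota> f (type_I_form \<iota> m \<epsilon> s)"
    and "1 \<le> s"
    and "s = 1 \<Longrightarrow> q \<noteq> 2"
  shows "code_dim C = m \<and>
    (\<forall>r\<in>{1..m}.
       (r = 1 \<longrightarrow>
          int (gen_hamming_weight C r)
            = int q ^ (m - 1) - int q ^ (m - s - 1) - int q ^ (m - 2)) \<and>
       (2 \<le> r \<and> r \<le> s \<longrightarrow>
          int (gen_hamming_weight C r)
            = int q ^ (m - 1) - int q ^ (m - s - 1) - int q ^ (m - r - 1) - int q ^ (m - s - 2)) \<and>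
       (2 \<le> s \<and> s < r \<and> r < m - 1 \<longrightarrow>
          int (gen_hamming_weight C r)
            = int q ^ (m - 1) - int q ^ (m - s - 1) - int q ^ (m - r - 1) - int q ^ (m - r - 2)) \<and>
       (r = m - 1 \<longrightarrow>
          int (gen_hamming_weight C r)
            = int q ^ (m - 1) - int q ^ (m - s - 1) - 1) \<and>
       (r = m \<longrightarrow>
          int (gen_hamming_weight C r)
            = int q ^ (m - 1) - int q ^ (m - s - 1)))"
proof -
  have q: "CARD('a) = q" and m: "0 < m" and sm: "2 * s < m" and s: "1 \<le> s" and a: "a \<noteq> 0"
    by fact+
  interpret char2_extension \<iota> m e
    using assms by unfold_locales auto
  obtain y where "type_I_space (ext_scale \<iota>) y m s f"
    using type_I_space_of_equivalent[OF \<open>is_basis \<iota> m \<epsilon>\<close> s sm] assms by blast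
  then interpret V: type_I_space "ext_scale \<iota>" y m s f .
  have q1: "1 < q" using V.q_gt_1 q by simp
  have inj: "inj (trace_word D)"
    by (rule inj_trace_word)
       (use V.level_set_not_subset_hyperplane[OF a] assms in \<open>auto simp: D_def\<close>)
  have WD: "W \<inter> D = {w\<in>W. f w = a}" for W
    by (auto simp: D_def)
  have cD: "card D + q ^ (m - s - 1) = q ^ (m - 1)"
    using V.card_level_set_UNIV[OF a] by (simp add: D_def q)
  \<comment> \<open>\<open>N\<close> is the largest number of points of \<open>D\<close> in a
    subspace of codimension \<open>r\<close>; each range of \<open>r\<close> below supplies the
    bound and an example.\<close>
  have weight: "int (gen_hamming_weight C r) = int q ^ (m - 1) - int q ^ (m - s - 1) - int N"
    if "r \<le> m" "\<And>W. subspace W \<Longrightarrow> card W = q ^ (m - r) \<Longrightarrow> card {w\<in>W. f w = a} \<le> N"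
      "\<exists>W. subspace W \<and> card W = q ^ (m - r) \<and> N \<le> card {w\<in>W. f w = a}" for r N
    using gen_hamming_weight_trace_code[OF inj that(1), of N] that(2,3) arg_cong[OF cD, of int]
    by (simp add: C_def WD q)
  have pow: "q ^ (m - r) = q * q ^ (m - r - 1)" if "r < m" for r
    using that by (simp add: Suc_diff_Suc flip: power_Suc)
  have pow2: "q ^ (m - r) = q\<^sup>2 * q ^ (m - r - 2)" if "r + 2 \<le> m" for r
  proof -
    have "m - r = 2 + (m - r - 2)" using that by simp
    then show ?thesis by (metis power_add)
  qed
  have type_II: "\<exists>W. subspace W \<and> card W = q ^ (m - r) \<and>
      q\<^sup>2 * card {w\<in>W. f w = a} = q * card W + q ^ (m - max r s)"
    if s2: "2 \<le> s" and r: "2 \<le> r" "r \<le> m - 2" for r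
  proof -
    let ?E = "(\<lambda>k. 2 * k) ` {3..s}"
    have E: "?E \<subseteq> {5..m}" "card ?E = s - 2"
      using sm by (auto simp: card_image inj_on_def)
    \<comment> \<open>\<open>J\<close> adds \<open>r - 2\<close> conditions to the two relations of
      the Type II subspace. For \<open>r \<le> s\<close> they are taken from the even indices
      \<open>?E\<close>, for \<open>r > s\<close> they include all of these; hence the
      \<open>max r s\<close>.\<close>
    obtain J where J: "J \<subseteq> {5..m}" "\<And>k. k \<in> {3..s} \<Longrightarrow> 2 * k - 1 \<in> J \<Longrightarrow> 2 * k \<in> J"
      "card J = r - 2" "card (J \<union> ?E) = max r s - 2"
    proof (cases "r \<le> s")
      case True
      let ?J = "(\<lambda>k. 2 * k) ` {3..r}"
      have "2 * k - 1 \<notin> ?J" if "k \<in> {3..s}" for k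
        using that by (auto, presburger)
      moreover have "?J \<union> ?E = ?E" using True by auto
      moreover have "card ?J = r - 2" by (simp add: card_image inj_on_def)
      ultimately show thesis
        using True sm E by (intro that[of ?J]) auto
    next
      case False
      have "card ?E \<le> r - 2" "r - 2 \<le> card {5..m}"
        using E(2) False r by auto
      then obtain J where J: "?E \<subseteq> J" "J \<subseteq> {5..m}" "card J = r - 2"
        using exists_subset_between[of ?E "r - 2" "{5..m}"] E(1) by auto
      moreover have "J \<union> ?E = J" using J(1) by blast
      ultimately show thesis
        using False by (intro that[of J]) auto
    qed
    have "m - 2 - card J = m - r" "m - 2 - card (J \<union> ?E) = m - max r s"
      using J(3,4) r s2 by auto
    then show ?thesis
      using V.ex_type_II_level_set[OF a s2 J(1,2)] by (simp add: q)
  qed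
  have r1: "int (gen_hamming_weight C 1) = int q ^ (m - 1) - int q ^ (m - s - 1) - int (q ^ (m - 2))"
  proof (rule weight)
    have e: "q ^ (m - 1) = q * q ^ (m - 2)"
      using pow[of 1] s sm by (simp add: numeral_2_eq_2)
    show "card {w\<in>W. f w = a} \<le> q ^ (m - 2)" if "subspace W" "card W = q ^ (m - 1)" for W
    proof -
      have "q * card {w\<in>W. f w = a} \<le> q * q ^ (m - 2)"
        using V.level_set_hyperplane_le[OF that(1) _ a] that(2) unfolding q e by simp
      then show ?thesis using q1 by simp
    qed
    obtain W where W: "subspace W" "card W = q ^ (m - 1)" "q * card {w\<in>W. f w = a} = q * q ^ (m - 2)"
      using V.ex_hyperplane_level_set[OF a] unfolding q e by metis
    then show "\<exists>W. subspace W \<and> card W = q ^ (m - 1) \<and> q ^ (m - 2) \<le> card {w\<in>W. f w = a}"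
      using q1 by (intro exI[of _ W]) simp
  qed (use m in simp)
  have r2: "int (gen_hamming_weight C r) = int q ^ (m - 1) - int q ^ (m - s - 1) - int (q ^ (m - r - 1) + q ^ (m - s - 2))"
    if r: "2 \<le> r" "r \<le> s" for r
  proof (rule weight)
    \<comment> \<open>Here \<open>max r s = s\<close>, and this expression is both the second bound
      of \<open>level_set_subspace_le\<close> and the Type II count.\<close>
    have e: "q * q ^ (m - r) + q ^ (m - s) = q\<^sup>2 * (q ^ (m - r - 1) + q ^ (m - s - 2))"
      using pow[of r] pow2[of s] r sm by (simp add: power2_eq_square distrib_left mult.assoc)
    show "card {w\<in>W. f w = a} \<le> q ^ (m - r - 1) + q ^ (m - s - 2)"
      if "subspace W" "card W = q ^ (m - r)" for W
    proof -
      have "q\<^sup>2 * card {w\<in>W. f w = a} \<le> q\<^sup>2 * (q ^ (m - r - 1) + q ^ (m - s - 2))"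
        using V.level_set_subspace_le(2)[OF that(1) a] unfolding q that(2) e .
      then show ?thesis using q1 by simp
    qed
    obtain W where W: "subspace W" "card W = q ^ (m - r)"
      "q\<^sup>2 * card {w\<in>W. f w = a} = q\<^sup>2 * (q ^ (m - r - 1) + q ^ (m - s - 2))"
    proof -
      have "2 \<le> s" "r \<le> m - 2" "max r s = s" using r sm by auto
      with type_II[of r] r that show thesis unfolding e[symmetric] by auto
    qed
    then show "\<exists>W. subspace W \<and> card W = q ^ (m - r) \<and> q ^ (m - r - 1) + q ^ (m - s - 2) \<le> card {w\<in>W. f w = a}"
      using q1 by (intro exI[of _ W]) simp
  qed (use r sm in simp)
  have r3: "int (gen_hamming_weight C r) = int q ^ (m - 1) - int q ^ (m - s - 1) - int (q ^ (m - r - 1) + q ^ (m - r - 2))"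
    if r: "2 \<le> s" "s < r" "r < m - 1" for r
  proof (rule weight)
    \<comment> \<open>Now \<open>max r s = r\<close>, and the Type II count meets the first bound
      instead.\<close>
    have e: "q * q ^ (m - r) + q ^ (m - r) = q\<^sup>2 * (q ^ (m - r - 1) + q ^ (m - r - 2))"
    proof -
      have "q * q ^ (m - r) = q\<^sup>2 * q ^ (m - r - 1)"
        using pow[of r] r by (simp add: power2_eq_square)
      moreover have "q ^ (m - r) = q\<^sup>2 * q ^ (m - r - 2)"
        using pow2[of r] r by simp
      ultimately show ?thesis by (simp only: distrib_left)
    qed
    show "card {w\<in>W. f w = a} \<le> q ^ (m - r - 1) + q ^ (m - r - 2)"
      if "subspace W" "card W = q ^ (m - r)" for W
    proof -
      have "q\<^sup>2 * card {w\<in>W. f w = a} \<le> q\<^sup>2 * (q ^ (m - r - 1) + q ^ (m - r - 2))"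
        using V.level_set_subspace_le(1)[OF that(1) a] unfolding q that(2) distrib_right mult_1 e .
      then show ?thesis using q1 by simp
    qed
    obtain W where W: "subspace W" "card W = q ^ (m - r)"
      "q\<^sup>2 * card {w\<in>W. f w = a} = q\<^sup>2 * (q ^ (m - r - 1) + q ^ (m - r - 2))"
    proof -
      have "2 \<le> r" "r \<le> m - 2" "max r s = r" using r by auto
      with type_II[of r] r that show thesis unfolding e[symmetric] by auto
    qed
    then show "\<exists>W. subspace W \<and> card W = q ^ (m - r) \<and> q ^ (m - r - 1) + q ^ (m - r - 2) \<le> card {w\<in>W. f w = a}"
      using q1 by (intro exI[of _ W]) simp
  qed (use r in simp)
  have r4: "int (gen_hamming_weight C (m - 1)) = int q ^ (m - 1) - int q ^ (m - s - 1) - int 1"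
  proof (rule weight)
    have e: "q ^ (m - (m - 1)) = q" using m by simp
    show "card {w\<in>W. f w = a} \<le> 1" if "subspace W" "card W = q ^ (m - (m - 1))" for W
      by (rule V.level_set_line_le[OF that(1) _ a]) (use that(2) in \<open>simp only: q e\<close>)
    show "\<exists>W. subspace W \<and> card W = q ^ (m - (m - 1)) \<and> 1 \<le> card {w\<in>W. f w = a}"
      using V.ex_line_level_set[OF a] unfolding q e .
  qed simp
  have r5: "int (gen_hamming_weight C m) = int q ^ (m - 1) - int q ^ (m - s - 1) - int 0"
  proof (rule weight)
    show "card {w\<in>W. f w = a} \<le> 0" if W: "subspace W" "card W = q ^ (m - m)" for W
    proof -
      have "card W = 1" using W(2) by simp
      then obtain w where "W = {w}" by (rule card_1_singletonE)
      then have "W = {0}" using subspace_0[OF W(1)] by auto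
      then show ?thesis using a V.f_zero by auto
    qed
    show "\<exists>W. subspace W \<and> card W = q ^ (m - m) \<and> 0 \<le> card {w\<in>W. f w = a}"
      by (intro exI[of _ "{0}"]) (simp add: subspace_single_0)
  qed simp
  have "code_dim C = m"
    unfolding C_def by (rule code_dim_trace_code[OF inj])
  then show ?thesis
    using r1 r2 r3 r4 r5 by (auto simp: diff_diff_eq)
qed

end
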